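(* Let $S_1$ be the Cartwright--Steger surface. Any finite \'etale abelian cover of $S_1$ has irregularity $q = 1$. In other words, there is no jumping in first cohomology for abelian covers: if $\Gamma = \pi_1(S_1)$ and $\alpha : \Gamma \to G$ is a surjective homomorphism onto a finite abelian group $G$, then $b_1(\ker \alpha) = b_1(\Gamma) = 2$.
   Context: For a smooth complex projective surface $S$, the irregularity is $q(S) = \dim_{\mathbb{C}} H^1(S, \mathcal{O}_S)$. For a finitely generated group $\Lambda$, $b_1(\Lambda)$ denotes its first betti number, i.e., the rank of $\Lambda^{ab} \otimes_{\mathbb{Z}} \mathbb{Q}$. A finite \'etale abelian cover of $S_1$ is the connected covering of $S_1$ associated with the kernel of a surjective homomorphism from $\pi_1(S_1)$ onto a finite abelian group. The Cartwright--Steger surface $S_1$ is a smooth complex projective surface of general type with $q(S_1)=1$, $p_g(S_1) = 1$, $c_2(S_1)=3$. It is a ball quotient $S_1 = \mathbb{B}^2/\Gamma$, where $\mathbb{B}^2$ is the unit ball in $\mathbb{C}^2$ and $\Gamma$ is a torsion-free cocompact lattice in $\mathrm{PU}(2,1)$. Its fundamental group $\Gamma$ (which, by Mostow--Siu rigidity, determines $\Gamma$ up to conjugacy in $\mathrm{Isom}(\mathbb{B}^2)$, hence $S_1$ up to biholomorphism or complex conjugation) has abelianization isomorphic to $\mathbb{Z}^2$ and is given by generators $x, y, z$ and the twelve relations $R_1 = \dots = R_{12} = 1$, where \begin{align*} R_1 =\,\, & y^{-1} z^{-2} x^{-3} z^{-1} x^{-1} z y^{-2} z^{-1} y x^{-3}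 \\ R_2 =\,\, & y^3 x^3 z y^{-1} z^{-1} x^{-3} y^{-2} z x z^{-1} x^{-1} \\ R_3 =\,\, & y z^{-1} x^{-1} z^{-1} x^{-3} y^{-3} z^{-1} x^{-3} z^{-1} y^{-1} z y \\ R_4 =\,\, & y z x y^3 x^3 z y^{-1} x^3 z^2 y^{-1} z^{-1} \\ R_5 =\,\, & z^{-1} x^{-3} y^{-3} z x^{-1} z^{-1} y^{-1} z x y^3 x^3 y \\ R_6 =\,\, & z^{-1} x^{-3} y^{-2} z^{-2} x^{-3} y^{-1} z x z^{-1} y^{-1} z y^2 z^{-1} x^{-2} \\ R_7 =\,\, & z x^{-1} z^{-1} y^2 x^3 z^2 x z^{-1} y^{-1} z y^2 z^{-2} x^{-3} y^{-3} \\ R_8 =\,\, & y x^2 z y^{-2} z^{-1} y x^{-3} z^{-2} x^{-3} y^{-3} z y z^{-2} x^{-3} \\ R_9 =\,\, & y^{-2} x y^3 z^{-1} y^{-1} z y^2 z^{-1} x^{-1} y^{-1} z x^3 y^{-1} z y^{-1} z y z^{-2} x^{-3} \\ R_{10} =\,\, & z^{-1} x^3 z^2 y^{-1} z^{-1} y^4 x^3 z y^{-1} z y^3 x^3 z y^{-1} z x z^{-1} x^{-3} y^{-2} \\ R_{11} =\,\, & z^{-1} x^{-3} y^{-3} z^{-1} y z y^{-2} z^{-1} y^4 x^3 z y^{-1} z x z^{-1} x^{-3} z^{-1} x^{-2} z y^{-1} z^{-2} x^{-3} \\ R_{12} =\,\, & y^{-1} z y z^{-2} x^{-3} y^3 x^3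 z x^2 z x^3 z x^{-1} z^{-1} y z^{-1} x^{-3} y^{-3} z^{-1} y z y^{-2} z^{-1} y z x^{-1} z^{-1} y^{-1} z \end{align*} *)

theory Defs
  imports "HOL-Algebra.Algebra" "HOL-Library.Extended_Nat"
begin

section \<open>Groups given by generators and relations\<close>

text \<open>
  A word is a list of letters; the letter \<open>(g, True)\<close> stands for the generator \<open>g\<close> and
  \<open>(g, False)\<close> for its inverse.  The generating set is the whole type \<open>'g\<close>.
\<close>

type_synonym 'g word = "('g \<times> bool) list"

inductive word_equiv :: "'g word set \<Rightarrow> 'g word \<Rightarrow> 'g word \<Rightarrow> bool" for R where
  refl: "word_equiv R u u"
| sym: "word_equiv R u v \<Longrightarrow> word_equiv R v u"
| trans: "word_equiv R u v \<Longrightarrow> word_equiv R v w \<Longrightarrow> word_equiv R u w"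
| cancel: "word_equiv R (u @ [(g, b), (g, \<not> b)] @ v) (u @ v)"
| relator: "r \<in> R \<Longrightarrow> word_equiv R (u @ r @ v) (u @ v)"

definition word_rel :: "'g word set \<Rightarrow> 'g word rel" where
  "word_rel R = {(u, v). word_equiv R u v}"

definition presented_group :: "'g word set \<Rightarrow> 'g word set monoid" where
  "presented_group R =
     \<lparr>carrier = UNIV // word_rel R,
      monoid.mult = (\<lambda>A B. \<Union>u\<in>A. \<Union>v\<in>B. word_rel R `` {u @ v}),
      one = word_rel R `` {[]}\<rparr>"

lemma equiv_word_rel: "equiv UNIV (word_rel R)"
  by (rule equivI)
    (auto simp: word_rel_def refl_on_def sym_def trans_def
      intro: word_equiv.refl word_equiv.sym word_equiv.trans)

lemma word_equiv_append_left: "word_equiv R u v \<Longrightarrow> word_equiv R (w @ u) (w @ v)"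
proof (induction rule: word_equiv.induct)
  case (cancel u g b v)
  show ?case using word_equiv.cancel[of R "w @ u" g b v] by simp
next
  case (relator r u v)
  then show ?case using word_equiv.relator[of r R "w @ u" v] by simp
qed (auto intro: word_equiv.intros)

lemma word_equiv_append_right: "word_equiv R u v \<Longrightarrow> word_equiv R (u @ w) (v @ w)"
proof (induction rule: word_equiv.induct)
  case (cancel u g b v)
  show ?case using word_equiv.cancel[of R u g b "v @ w"] by simp
next
  case (relator r u v)
  then show ?case using word_equiv.relator[of r R u "v @ w"] by simp
qed (auto intro: word_equiv.intros)

lemma word_equiv_append:
  "word_equiv R u u' \<Longrightarrow> word_equiv R v v' \<Longrightarrow> word_equiv R (u @ v) (u' @ v')"
  by (meson word_equiv.trans word_equiv_append_left word_equiv_append_right)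

lemma presented_group_mult:
  "word_rel R `` {u} \<otimes>\<^bsub>presented_group R\<^esub> word_rel R `` {v} = word_rel R `` {u @ v}"
proof -
  have "congruent2 (word_rel R) (word_rel R) (\<lambda>u v. word_rel R `` {u @ v})"
    unfolding congruent2_def
    by (auto simp: word_rel_def intro: word_equiv_append word_equiv.sym word_equiv.trans)
  then show ?thesis
    unfolding presented_group_def
    by (simp add: UN_equiv_class2[OF equiv_word_rel equiv_word_rel])
qed

lemma word_equiv_inverse_left:
  "word_equiv R (rev (map (\<lambda>(g, b). (g, \<not> b)) u) @ u) []"
proof (induction u)
  case Nil
  show ?case by (simp add: word_equiv.refl)
next
  case (Cons l u)
  obtain g b where l: "l = (g, b)" by (cases l)
  let ?i = "rev (map (\<lambda>(g, b). (g, \<not> b)) u)"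
  have "word_equiv R (?i @ [(g, \<not> b), (g, \<not> \<not> b)] @ u) (?i @ u)"
    by (rule word_equiv.cancel)
  then show ?case using Cons by (auto simp: l intro: word_equiv.trans)
qed

lemma group_presented_group: "group (presented_group R)"
proof (rule groupI)
  fix a b assume "a \<in> carrier (presented_group R)" "b \<in> carrier (presented_group R)"
  then obtain u v where "a = word_rel R `` {u}" "b = word_rel R `` {v}"
    by (auto simp: presented_group_def quotient_def)
  then show "a \<otimes>\<^bsub>presented_group R\<^esub> b \<in> carrier (presented_group R)"
    by (simp add: presented_group_mult) (simp add: presented_group_def quotientI)
next
  show "\<one>\<^bsub>presented_group R\<^esub> \<in> carrier (presented_group R)"
    by (simp add: presented_group_def quotientI)
next
  fix a b c
  assume "a \<in> carrier (presented_group R)" "b \<in> carrier (presented_group R)"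
    "c \<in> carrier (presented_group R)"
  then obtain u v w where "a = word_rel R `` {u}" "b = word_rel R `` {v}" "c = word_rel R `` {w}"
    by (auto simp: presented_group_def quotient_def)
  then show "a \<otimes>\<^bsub>presented_group R\<^esub> b \<otimes>\<^bsub>presented_group R\<^esub> c =
      a \<otimes>\<^bsub>presented_group R\<^esub> (b \<otimes>\<^bsub>presented_group R\<^esub> c)"
    by (simp add: presented_group_mult)
next
  fix a assume "a \<in> carrier (presented_group R)"
  then obtain u where a: "a = word_rel R `` {u}"
    by (auto simp: presented_group_def quotient_def)
  have one: "\<one>\<^bsub>presented_group R\<^esub> = word_rel R `` {[]}"
    by (simp add: presented_group_def)
  show "\<one>\<^bsub>presented_group R\<^esub> \<otimes>\<^bsub>presented_group R\<^esub> a = a"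
    by (simp add: a one presented_group_mult)
  let ?i = "rev (map (\<lambda>(g, b). (g, \<not> b)) u)"
  have "(?i @ u, []) \<in> word_rel R"
    by (simp add: word_rel_def word_equiv_inverse_left)
  then have "word_rel R `` {?i @ u} = word_rel R `` {[]}"
    by (rule equiv_class_eq[OF equiv_word_rel])
  then show "\<exists>b\<in>carrier (presented_group R).
      b \<otimes>\<^bsub>presented_group R\<^esub> a = \<one>\<^bsub>presented_group R\<^esub>"
    by (intro bexI[of _ "word_rel R `` {?i}"])
      (simp_all only: a one presented_group_mult, simp add: presented_group_def quotientI)
qed


section \<open>The fundamental group of the Cartwright-Steger surface\<close>

datatype cs_gen = gx | gy | gz

text \<open>
  The Cartwright-Steger surface is represented by its fundamental group, which determines it up to
  biholomorphism or complex conjugation.  Its finite etale abelian covers are those associated with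
  the kernels of epimorphisms from this group onto finite abelian groups; by Hodge theory the
  irregularity of such a cover is half the first Betti number of the kernel.

  Relators are written as lists of syllables: \<open>(g, n)\<close> stands for the power of \<open>g\<close> with exponent \<open>n\<close>.
\<close>

definition syllables_word :: "('g \<times> int) list \<Rightarrow> 'g word" where
  "syllables_word ss = concat (map (\<lambda>(g, n). replicate (nat \<bar>n\<bar>) (g, 0 < n)) ss)"

definition cs_relators :: "(cs_gen \<times> int) list list" where
  "cs_relators = [
    [(gy, -1), (gz, -2), (gx, -3), (gz, -1), (gx, -1), (gz, 1), (gy, -2), (gz, -1), (gy, 1),
     (gx, -3)],
    [(gy, 3), (gx, 3), (gz, 1), (gy, -1), (gz, -1), (gx, -3), (gy, -2), (gz, 1), (gx, 1),
     (gz, -1), (gx, -1)],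
    [(gy, 1), (gz, -1), (gx, -1), (gz, -1), (gx, -3), (gy, -3), (gz, -1), (gx, -3),
     (gz, -1), (gy, -1), (gz, 1), (gy, 1)],
    [(gy, 1), (gz, 1), (gx, 1), (gy, 3), (gx, 3), (gz, 1), (gy, -1), (gx, 3), (gz, 2),
     (gy, -1), (gz, -1)],
    [(gz, -1), (gx, -3), (gy, -3), (gz, 1), (gx, -1), (gz, -1), (gy, -1), (gz, 1), (gx, 1),
     (gy, 3), (gx, 3), (gy, 1)],
    [(gz, -1), (gx, -3), (gy, -2), (gz, -2), (gx, -3), (gy, -1), (gz, 1), (gx, 1), (gz, -1),
     (gy, -1), (gz, 1), (gy, 2), (gz, -1), (gx, -2)],
    [(gz, 1), (gx, -1), (gz, -1), (gy, 2), (gx, 3), (gz, 2), (gx, 1), (gz, -1), (gy, -1),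
     (gz, 1), (gy, 2), (gz, -2), (gx, -3), (gy, -3)],
    [(gy, 1), (gx, 2), (gz, 1), (gy, -2), (gz, -1), (gy, 1), (gx, -3), (gz, -2), (gx, -3),
     (gy, -3), (gz, 1), (gy, 1), (gz, -2), (gx, -3)],
    [(gy, -2), (gx, 1), (gy, 3), (gz, -1), (gy, -1), (gz, 1), (gy, 2), (gz, -1), (gx, -1),
     (gy, -1), (gz, 1), (gx, 3), (gy, -1), (gz, 1), (gy, -1), (gz, 1), (gy, 1), (gz, -2),
     (gx, -3)],
    [(gz, -1), (gx, 3), (gz, 2), (gy, -1), (gz, -1), (gy, 4), (gx, 3), (gz, 1), (gy, -1),
     (gz, 1), (gy, 3), (gx, 3), (gz, 1), (gy, -1), (gz, 1), (gx, 1), (gz, -1), (gx, -3),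
     (gy, -2)],
    [(gz, -1), (gx, -3), (gy, -3), (gz, -1), (gy, 1), (gz, 1), (gy, -2), (gz, -1), (gy, 4),
     (gx, 3), (gz, 1), (gy, -1), (gz, 1), (gx, 1), (gz, -1), (gx, -3), (gz, -1), (gx, -2),
     (gz, 1), (gy, -1), (gz, -2), (gx, -3)],
    [(gy, -1), (gz, 1), (gy, 1), (gz, -2), (gx, -3), (gy, 3), (gx, 3), (gz, 1), (gx, 2),
     (gz, 1), (gx, 3), (gz, 1), (gx, -1), (gz, -1), (gy, 1), (gz, -1), (gx, -3), (gy, -3),
     (gz, -1), (gy, 1), (gz, 1), (gy, -2), (gz, -1), (gy, 1), (gz, 1), (gx, -1), (gz, -1),
     (gy, -1), (gz, 1)]
  ]"

definition cartwright_steger_group :: "cs_gen word set monoid" where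
  "cartwright_steger_group = presented_group (set (map syllables_word cs_relators))"


section \<open>The first Betti number of a group\<close>

definition abelianization :: "('a, 'm) monoid_scheme \<Rightarrow> 'a set monoid" where
  "abelianization G = G Mod derived G (carrier G)"

text \<open>The tensor product over the integers of two (multiplicatively written) abelian groups.\<close>

definition tensor_relations ::
    "('a, 'm) monoid_scheme \<Rightarrow> ('b, 'n) monoid_scheme \<Rightarrow> ('a \<times> 'b \<Rightarrow>\<^sub>0 int) set" where
  "tensor_relations A B =
     {frag_of (a \<otimes>\<^bsub>A\<^esub> a', b) - frag_of (a, b) - frag_of (a', b) | a a' b.
        a \<in> carrier A \<and> a' \<in> carrier A \<and> b \<in> carrier B} \<union>
     {frag_of (a, b \<otimes>\<^bsub>B\<^esub> b') - frag_of (a, b) - frag_of (a, b') | a b b'.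
        a \<in> carrier A \<and> b \<in> carrier B \<and> b' \<in> carrier B}"

definition tensor_product ::
    "('a, 'm) monoid_scheme \<Rightarrow> ('b, 'n) monoid_scheme \<Rightarrow> ('a \<times> 'b \<Rightarrow>\<^sub>0 int) set monoid" where
  "tensor_product A B =
     (let F = free_Abelian_group (carrier A \<times> carrier B)
      in F Mod generate F (tensor_relations A B))"

definition rat_group :: "rat monoid" where
  "rat_group = \<lparr>carrier = UNIV, monoid.mult = (+), one = 0\<rparr>"

definition int_independent :: "('a, 'm) monoid_scheme \<Rightarrow> 'a set \<Rightarrow> bool" where
  "int_independent A B \<longleftrightarrow>
     (\<forall>c :: 'a \<Rightarrow> int. finprod A (\<lambda>b. b [^]\<^bsub>A\<^esub> c b) B = \<one>\<^bsub>A\<^esub> \<longrightarrow> (\<forall>b\<in>B. c b = 0))"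

text \<open>
  The rank of an abelian group is the supremum of the sizes of its finite \<open>\<int>\<close>-independent subsets.
  If the group is a rational vector space, clearing denominators shows that \<open>\<int>\<close>-independence is
  linear independence over the rationals, so that the rank is then the dimension.
  The value \<open>\<infinity>\<close> is allowed, so that no finiteness is built into the definition.
\<close>

definition abelian_rank :: "('a, 'm) monoid_scheme \<Rightarrow> enat" where
  "abelian_rank A = (SUP B \<in> {B. finite B \<and> B \<subseteq> carrier A \<and> int_independent A B}. enat (card B))"

definition first_betti :: "('a, 'm) monoid_scheme \<Rightarrow> enat" where
  "first_betti G = abelian_rank (tensor_product (abelianization G) rat_group)"

end

theory Submission
  imports Defs
begin

text \<open>
  Let \<open>\<Gamma>\<close> be the fundamental group of the Cartwright-Steger surface, with derived subgroup
  \<open>\<Gamma>'\<close> and second derived subgroup \<open>\<Gamma>''\<close>.  The abelianization of \<open>\<Gamma>\<close> is \<open>\<int>\<^sup>2\<close>, and the whole theorem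
  rests on one fact about the Alexander module \<open>\<Gamma>'/\<Gamma>''\<close>: it has exponent dividing 56.
  That there is no jumping for any finite abelian cover follows at once.  If \<open>\<Gamma>/K\<close> is abelian, then
  \<open>\<Gamma>' \<le> K\<close>, hence \<open>\<Gamma>'' \<le> K'\<close>; so the kernel of \<open>K/K' \<rightarrow> \<Gamma>/\<Gamma>' = \<int>\<^sup>2\<close> is a torsion group.  If \<open>K\<close> has
  finite index as well, the image of this map has rank 2, and so has \<open>K/K'\<close>.  The passage from
  this statement to the rank of \<open>K/K' \<otimes> \<rat>\<close> is \<open>first_betti_eq_2\<close>.

  For the fact itself, replace \<open>x, y, z\<close> by the generators \<open>x\<close>, \<open>t = x\<^sup>3 y z\<close> and \<open>f = z t\<^sup>2 x\<close>.
  The exponents of every relator in \<open>(x, y, z)\<close> are a multiple of \<open>(7, 2, 3)\<close>, which are those of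
  \<open>f\<close>, and for the first relator the factor is \<open>-1\<close>; so \<open>f\<close> lies in \<open>\<Gamma>'\<close>, and \<open>x\<close> and \<open>t\<close> map to a
  basis of \<open>\<int>\<^sup>2\<close>.  Taking the products \<open>x\<^sup>i t\<^sup>j\<close> as a transversal of \<open>\<Gamma>'\<close>, Reidemeister-Schreier
  rewriting presents \<open>\<Gamma>'/\<Gamma>''\<close> as a module over the group ring of \<open>\<int>\<^sup>2\<close> with two generators, the
  commutator \<open>[t, x]\<close> and \<open>f\<close>, and one relation for each of the twelve relators.
  Geometrically, a closed word is a closed path in the grid \<open>\<int>\<^sup>2\<close> with a loop \<open>f\<close> attached at every
  vertex; modulo \<open>\<Gamma>''\<close> it is the sum of the translates of \<open>[t, x]\<close> for the grid squares that it
  encloses (counted with winding number) and of the translates of \<open>f\<close> for the loops that it runs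
  through.

  It remains to see that 56 times each generator is an integral combination of translates of the
  relations.  Two such combinations are written down as \<open>square_certificate\<close> and \<open>loop_certificate\<close>
  and verified by computation.  The consequence in the group is \<open>cs_word_pow_eq_one\<close>: in a quotient
  of \<open>\<Gamma>\<close> that is an extension of an abelian group by an abelian group, a word that becomes
  trivial in \<open>\<int>\<^sup>2\<close> has 56th power 1.
\<close>

section \<open>Words and their values in a group\<close>

primrec word_value :: "('a, 'm) monoid_scheme \<Rightarrow> ('g \<Rightarrow> 'a) \<Rightarrow> 'g word \<Rightarrow> 'a" where
  "word_value G \<rho> [] = \<one>\<^bsub>G\<^esub>"
| "word_value G \<rho> (l # w) =
     (if snd l then \<rho> (fst l) else inv\<^bsub>G\<^esub> (\<rho> (fst l))) \<otimes>\<^bsub>G\<^esub> word_value G \<rho> w"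

definition inverse_word :: "'g word \<Rightarrow> 'g word" where
  "inverse_word w = rev (map (\<lambda>(g, b). (g, \<not> b)) w)"

definition substitute :: "('g \<Rightarrow> 'h word) \<Rightarrow> 'g word \<Rightarrow> 'h word" where
  "substitute s w = concat (map (\<lambda>(g, b). if b then s g else inverse_word (s g)) w)"

primrec exponent_sum :: "('g \<Rightarrow> int) \<Rightarrow> 'g word \<Rightarrow> int" where
  "exponent_sum d [] = 0"
| "exponent_sum d (l # w) = (if snd l then d (fst l) else - d (fst l)) + exponent_sum d w"

lemma exponent_sum_append [simp]: "exponent_sum d (u @ v) = exponent_sum d u + exponent_sum d v"
  by (induction u) auto

lemma exponent_sum_inverse_word [simp]: "exponent_sum d (inverse_word w) = - exponent_sum d w"
  by (induction w) (auto simp: inverse_word_def)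

lemma exponent_sum_substitute:
  "exponent_sum d (substitute s w) = exponent_sum (\<lambda>g. exponent_sum d (s g)) w"
  by (induction w) (auto simp: substitute_def)

lemma exponent_sum_word_equiv:
  assumes "word_equiv R u v" and "\<And>r. r \<in> R \<Longrightarrow> exponent_sum d r = 0"
  shows "exponent_sum d u = exponent_sum d v"
  using assms by (induction rule: word_equiv.induct) auto

context group
begin

lemma inv_cancel_left [simp]:
  "\<lbrakk>u \<in> carrier G; v \<in> carrier G\<rbrakk> \<Longrightarrow> u \<otimes> (inv u \<otimes> v) = v"
  "\<lbrakk>u \<in> carrier G; v \<in> carrier G\<rbrakk> \<Longrightarrow> inv u \<otimes> (u \<otimes> v) = v"
  by (simp_all flip: m_assoc)

lemma int_pow_commute:
  assumes "a \<otimes> b = b \<otimes> a" and [simp]: "a \<in> carrier G" "b \<in> carrier G"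
  shows "a [^] (i :: int) \<otimes> b [^] (j :: int) = b [^] j \<otimes> a [^] i"
proof -
  have one: "u [^] (i :: int) \<otimes> v = v \<otimes> u [^] i"
    if [simp]: "u \<in> carrier G" "v \<in> carrier G" and uv: "u \<otimes> v = v \<otimes> u" for u v i
  proof (cases i rule: int_cases)
    case (nonneg n)
    then show ?thesis by (simp add: int_pow_int group_commutes_pow uv)
  next
    case (neg n)
    have swap: "b \<otimes> inv a = inv a \<otimes> b"
      if "a \<in> carrier G" "b \<in> carrier G" "a \<otimes> b = b \<otimes> a" for a b
      using that by (metis inv_cancel_left(2) inv_closed inv_solve_right m_assoc m_closed)
    have "u [^] Suc n \<otimes> v = v \<otimes> u [^] Suc n"
      by (rule group_commutes_pow) (simp_all add: uv)
    then have "v \<otimes> inv (u [^] Suc n) = inv (u [^] Suc n) \<otimes> v"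
      by (intro swap) simp_all
    then show ?thesis
      unfolding neg by (simp add: int_pow_neg_int del: of_nat_Suc nat_pow_Suc)
  qed
  show ?thesis
    by (rule one) (simp_all add: one assms(1))
qed

lemma word_value_closed [simp]: "range \<rho> \<subseteq> carrier G \<Longrightarrow> word_value G \<rho> w \<in> carrier G"
  by (induction w) auto

lemma word_value_append:
  "range \<rho> \<subseteq> carrier G \<Longrightarrow> word_value G \<rho> (u @ v) = word_value G \<rho> u \<otimes> word_value G \<rho> v"
  by (induction u) (auto simp: m_assoc range_subsetD)

lemma word_value_inverse_word:
  assumes "range \<rho> \<subseteq> carrier G"
  shows "word_value G \<rho> (inverse_word w) = inv (word_value G \<rho> w)"
proof (induction w)
  case (Cons l w)
  have "word_value G \<rho> (inverse_word (l # w)) =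
      word_value G \<rho> (inverse_word w) \<otimes> word_value G \<rho> [(fst l, \<not> snd l)]"
    using assms by (simp add: inverse_word_def word_value_append case_prod_unfold)
  with Cons assms show ?case
    by (auto simp: inv_mult_group range_subsetD)
qed (simp add: inverse_word_def)

lemma word_value_substitute:
  assumes "range \<sigma> \<subseteq> carrier G" and "\<And>g. word_value G \<sigma> (s g) = \<rho> g"
  shows "word_value G \<sigma> (substitute s w) = word_value G \<rho> w"
  using assms
  by (induction w) (auto simp: substitute_def word_value_append word_value_inverse_word)

end

lemma (in group_hom) word_value_hom:
  "range \<rho> \<subseteq> carrier G \<Longrightarrow> h (word_value G \<rho> w) = word_value H (h \<circ> \<rho>) w"
  by (induction w) (auto simp: range_subsetD)

lemma (in comm_group) word_value_eq_finprod:
  fixes \<rho> :: "'g :: finite \<Rightarrow> 'a"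
  assumes \<rho>: "range \<rho> \<subseteq> carrier G"
  shows "word_value G \<rho> w = finprod G (\<lambda>g. \<rho> g [^] exponent_sum (\<lambda>k. of_bool (k = g)) w) UNIV"
proof (induction w)
  case (Cons l w)
  define s :: int where "s = (if snd l then 1 else -1)"
  have [simp]: "\<rho> g \<in> carrier G" for g
    using \<rho> by blast
  have "(if snd l then \<rho> (fst l) else inv \<rho> (fst l)) = \<rho> (fst l) [^] s"
    by (simp add: s_def int_pow_neg)
  also have "\<dots> = finprod G (\<lambda>g. if fst l = g then \<rho> g [^] s else \<one>) UNIV"
    by (rule finprod_singleton[symmetric]) simp_all
  finally have "word_value G \<rho> (l # w) =
      finprod G (\<lambda>g. if fst l = g then \<rho> g [^] s else \<one>) UNIV \<otimes>
      finprod G (\<lambda>g. \<rho> g [^] exponent_sum (\<lambda>k. of_bool (k = g)) w) UNIV"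
    using Cons by simp
  also have "\<dots> = finprod G (\<lambda>g. (if fst l = g then \<rho> g [^] s else \<one>) \<otimes>
      \<rho> g [^] exponent_sum (\<lambda>k. of_bool (k = g)) w) UNIV"
    by (rule finprod_multf[symmetric]) simp_all
  also have "\<dots> = finprod G (\<lambda>g. \<rho> g [^] exponent_sum (\<lambda>k. of_bool (k = g)) (l # w)) UNIV"
    by (rule finprod_cong') (auto simp: s_def int_pow_mult int_pow_neg)
  finally show ?case .
qed simp

lemma (in comm_group) word_value_eq_one:
  fixes \<rho> :: "'g :: finite \<Rightarrow> 'a"
  assumes "range \<rho> \<subseteq> carrier G" and "\<And>g. exponent_sum (\<lambda>k. of_bool (k = g)) w = 0"
  shows "word_value G \<rho> w = \<one>"
  using assms by (simp add: word_value_eq_finprod)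

section \<open>Chains on the grid\<close>

datatype letter = Lx | Lt | Lf

text \<open>
  \<open>Square i j\<close> is the unit square of the grid with lower left corner \<open>(i, j)\<close>, and \<open>Loop i j\<close> the
  loop at the vertex \<open>(i, j)\<close>.  Chains with integer coefficients form a free module of rank 2 over
  the group ring of \<open>\<int>\<^sup>2\<close>.  They are lists, not functions, in order to be computed with.
\<close>

datatype cell = Square int int | Loop int int

type_synonym chain = "(cell \<times> int) list"

definition neg_chain :: "chain \<Rightarrow> chain" where
  "neg_chain = map (\<lambda>(c, k). (c, - k))"

text \<open>
  The squares between the horizontal axis and the horizontal edge from \<open>(i, j)\<close> to \<open>(i + 1, j)\<close>,
  with sign.  Depending on the sign of \<open>j\<close>, at least one of the two lists is empty.
\<close>

definition column :: "int \<Rightarrow> int \<Rightarrow> chain" where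
  "column i j = map (\<lambda>k. (Square i k, 1)) [0..j - 1] @ map (\<lambda>k. (Square i k, -1)) [j..-1]"

text \<open>
  The chain of a path that starts at \<open>(i, j)\<close>.  The reference path to a vertex runs first along the
  horizontal axis and then vertically; so vertical edges cost nothing, and a horizontal edge
  contributes the column of squares between it and the axis.
\<close>

fun path_chain :: "int \<Rightarrow> int \<Rightarrow> letter word \<Rightarrow> chain" where
  "path_chain i j [] = []"
| "path_chain i j ((Lx, b) # w) =
     (if b then column i j @ path_chain (i + 1) j w
      else neg_chain (column (i - 1) j) @ path_chain (i - 1) j w)"
| "path_chain i j ((Lt, b) # w) = path_chain i (if b then j + 1 else j - 1) w"
| "path_chain i j ((Lf, b) # w) = (Loop i j, if b then 1 else -1) # path_chain i j w"

fun less_cell :: "cell \<Rightarrow> cell \<Rightarrow> bool" where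
  "less_cell (Square i j) (Square k l) = (i < k \<or> (i = k \<and> j < l))"
| "less_cell (Square i j) (Loop k l) = True"
| "less_cell (Loop i j) (Square k l) = False"
| "less_cell (Loop i j) (Loop k l) = (i < k \<or> (i = k \<and> j < l))"

text \<open>
  Lists sorted by cells are merged, so that all terms of a combination that belong to the same cell
  meet and can cancel.
\<close>

fun add_chain :: "chain \<Rightarrow> chain \<Rightarrow> chain" where
  "add_chain [] v = v"
| "add_chain u [] = u"
| "add_chain ((c, k) # u) ((d, l) # v) =
     (if c = d then (if k + l = 0 then add_chain u v else (c, k + l) # add_chain u v)
      else if less_cell c d then (c, k) # add_chain u ((d, l) # v)
      else (d, l) # add_chain ((c, k) # u) v)"

definition sort_chain :: "chain \<Rightarrow> chain" where
  "sort_chain u = foldr (\<lambda>p. add_chain [p]) u []"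

fun translate_cell :: "int \<Rightarrow> int \<Rightarrow> cell \<Rightarrow> cell" where
  "translate_cell a b (Square i j) = Square (a + i) (b + j)"
| "translate_cell a b (Loop i j) = Loop (a + i) (b + j)"

definition translate_chain :: "int \<Rightarrow> int \<Rightarrow> int \<Rightarrow> chain \<Rightarrow> chain" where
  "translate_chain a b k = map (\<lambda>(c, l). (translate_cell a b c, k * l))"

text \<open>
  The certificate lists, for each chain, the translations \<open>(a, b)\<close> in use with their coefficients
  \<open>k\<close>: it is a vector of Laurent polynomials, paired here with a vector of chains.
\<close>

definition chain_combination :: "chain list \<Rightarrow> (int \<times> int \<times> int) list list \<Rightarrow> chain" where
  "chain_combination us cert =
     foldr (\<lambda>(u, ps). foldr (\<lambda>(a, b, k). add_chain (translate_chain a b k u)) ps) (zip us cert) []"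

section \<open>Rewriting in metabelian groups\<close>

text \<open>
  An abelian normal subgroup \<open>H\<close> is a module over the group ring of the quotient, with the action by
  conjugation; \<open>conjugate_same_coset\<close> is what makes this action factor through the quotient.
\<close>

locale abelian_normal = normal +
  assumes commute: "\<lbrakk>u \<in> H; v \<in> H\<rbrakk> \<Longrightarrow> u \<otimes> v = v \<otimes> u"
begin

definition conjugate :: "'a \<Rightarrow> 'a \<Rightarrow> 'a" where "conjugate g u = g \<otimes> u \<otimes> inv g"

lemma int_pow_in [simp]: "u \<in> H \<Longrightarrow> u [^] (k :: int) \<in> H"
  by (rule subgroup_int_pow_closed[OF is_subgroup])

lemma left_commute: "\<lbrakk>u \<in> H; v \<in> H; w \<in> H\<rbrakk> \<Longrightarrow> u \<otimes> (v \<otimes> w) = v \<otimes> (u \<otimes> w)"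
  by (metis commute m_assoc mem_carrier)

lemmas commute_ac = m_assoc commute left_commute

lemma conjugate_in [simp]: "\<lbrakk>g \<in> carrier G; u \<in> H\<rbrakk> \<Longrightarrow> conjugate g u \<in> H"
  by (simp add: conjugate_def inv_op_closed2)

lemma conjugate_one [simp]: "g \<in> carrier G \<Longrightarrow> conjugate g \<one> = \<one>"
  by (simp add: conjugate_def)

lemma one_conjugate [simp]: "u \<in> carrier G \<Longrightarrow> conjugate \<one> u = u"
  by (simp add: conjugate_def)

lemma conjugate_mult:
  "\<lbrakk>g \<in> carrier G; u \<in> carrier G; v \<in> carrier G\<rbrakk> \<Longrightarrow> conjugate g (u \<otimes> v) = conjugate g u \<otimes> conjugate g v"
  by (simp add: conjugate_def m_assoc)

lemma conjugate_conjugate: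
  "\<lbrakk>g \<in> carrier G; h \<in> carrier G; u \<in> carrier G\<rbrakk> \<Longrightarrow> conjugate g (conjugate h u) = conjugate (g \<otimes> h) u"
  by (simp add: conjugate_def m_assoc inv_mult_group)

lemma conjugate_hom: "g \<in> carrier G \<Longrightarrow> group_hom G G (conjugate g)"
  by (intro group_hom.intro group_hom_axioms.intro is_group homI)
    (simp_all add: conjugate_mult, simp add: conjugate_def)

lemma conjugate_int_pow:
  "\<lbrakk>g \<in> carrier G; u \<in> carrier G\<rbrakk> \<Longrightarrow> conjugate g (u [^] (k :: int)) = conjugate g u [^] k"
  by (rule group_hom.hom_int_pow[OF conjugate_hom])

lemma conjugate_same_coset:
  assumes "g \<in> carrier G" "h \<in> carrier G" "H #> g = H #> h" "u \<in> H"
  shows "conjugate g u = conjugate h u"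
proof -
  have "g \<in> H #> h"
    using assms(1,3) rcos_self is_subgroup by auto
  then obtain n where n: "n \<in> H" "g = n \<otimes> h"
    by (auto simp: r_coset_def)
  have "conjugate h u \<in> H"
    using assms by simp
  then have "conjugate n (conjugate h u) = conjugate h u"
    unfolding conjugate_def[of n] using n commute[of n "conjugate h u"] by (simp add: m_assoc)
  then show ?thesis
    using n assms by (simp add: conjugate_conjugate m_assoc)
qed

lemma int_pow_mult_in:
  "\<lbrakk>u \<in> H; v \<in> H\<rbrakk> \<Longrightarrow> (u \<otimes> v) [^] (k :: int) = u [^] k \<otimes> v [^] k"
  by (simp add: int_pow_mult_distrib commute)

end

text \<open>
  A map from the grid with loops to the group \<open>G\<close>: modulo \<open>H\<close>, the elements \<open>x\<close> and \<open>t\<close> generate an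
  image of \<open>\<int>\<^sup>2\<close>, and the loop \<open>f\<close> disappears.
\<close>

locale lattice_transversal = abelian_normal +
  fixes x t f :: 'a
  assumes xt [simp]: "x \<in> carrier G" "t \<in> carrier G" and f [simp]: "f \<in> H"
    and comm: "H #> (t \<otimes> x) = H #> (x \<otimes> t)"
begin

definition transversal :: "int \<Rightarrow> int \<Rightarrow> 'a" where "transversal i j = x [^] i \<otimes> t [^] j"

definition square :: 'a where "square = t \<otimes> x \<otimes> inv t \<otimes> inv x"

lemma transversal_closed [simp]: "transversal i j \<in> carrier G"
  by (simp add: transversal_def)

lemma square_in [simp]: "square \<in> H"
proof -
  have "t \<otimes> x \<in> H #> (x \<otimes> t)"
    using rcos_self[of "t \<otimes> x" H] comm is_subgroup by simp
  then obtain n where n: "n \<in> H" "t \<otimes> x = n \<otimes> (x \<otimes> t)"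
    by (auto simp: r_coset_def)
  then have "square = n"
    by (simp add: square_def m_assoc)
  with n show ?thesis by simp
qed

lemma coset_transversal_mult:
  "H #> (transversal i j \<otimes> transversal k l) = H #> transversal (i + k) (j + l)"
proof -
  interpret M: group "G Mod H" by (rule factorgroup_is_group)
  have closed: "H #> g \<in> carrier (G Mod H)" if "g \<in> carrier G" for g
    using that by (simp add: carrier_FactGroup)
  have "(H #> t) \<otimes>\<^bsub>G Mod H\<^esub> (H #> x) = (H #> x) \<otimes>\<^bsub>G Mod H\<^esub> (H #> t)"
    using comm by (simp add: rcos_sum)
  then have "(H #> t) [^]\<^bsub>G Mod H\<^esub> j \<otimes>\<^bsub>G Mod H\<^esub> (H #> x) [^]\<^bsub>G Mod H\<^esub> k =
      (H #> x) [^]\<^bsub>G Mod H\<^esub> k \<otimes>\<^bsub>G Mod H\<^esub> (H #> t) [^]\<^bsub>G Mod H\<^esub> j"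
    by (rule M.int_pow_commute) (simp_all add: closed)
  then have swap: "H #> (t [^] j \<otimes> x [^] k) = H #> (x [^] k \<otimes> t [^] j)"
    by (simp add: FactGroup_int_pow rcos_sum)
  have "H #> (transversal i j \<otimes> transversal k l) = H #> (x [^] i \<otimes> (t [^] j \<otimes> x [^] k) \<otimes> t [^] l)"
    by (simp add: transversal_def m_assoc)
  also have "\<dots> = (H #> x [^] i) <#> (H #> (t [^] j \<otimes> x [^] k)) <#> (H #> t [^] l)"
    by (simp add: rcos_sum)
  also have "\<dots> = H #> (x [^] i \<otimes> (x [^] k \<otimes> t [^] j) \<otimes> t [^] l)"
    unfolding swap by (simp add: rcos_sum)
  also have "x [^] i \<otimes> (x [^] k \<otimes> t [^] j) \<otimes> t [^] l = transversal (i + k) (j + l)"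
    by (simp add: transversal_def int_pow_mult m_assoc)
  finally show ?thesis .
qed

text \<open>
  The products \<open>x\<^sup>i t\<^sup>j\<close> are closed under multiplication only modulo \<open>H\<close>, but elements of \<open>H\<close> act trivially
  on \<open>H\<close>.  So conjugation by the transversal is an action of \<open>\<int>\<^sup>2\<close>, which is translation of cells.
\<close>

lemma conjugate_transversal:
  "u \<in> H \<Longrightarrow> conjugate (transversal i j) (conjugate (transversal k l) u) =
     conjugate (transversal (i + k) (j + l)) u"
  by (simp add: conjugate_conjugate conjugate_same_coset[OF _ _ coset_transversal_mult])

primrec cell_value :: "cell \<Rightarrow> 'a" where
  "cell_value (Square i j) = conjugate (transversal i j) square"
| "cell_value (Loop i j) = conjugate (transversal i j) f"

primrec chain_value :: "chain \<Rightarrow> 'a" where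
  "chain_value [] = \<one>"
| "chain_value (p # u) = cell_value (fst p) [^] snd p \<otimes> chain_value u"

lemma cell_value_in [simp]: "cell_value c \<in> H"
  by (cases c) simp_all

lemma chain_value_in [simp]: "chain_value u \<in> H"
  by (induction u) simp_all

lemma chain_value_append: "chain_value (u @ v) = chain_value u \<otimes> chain_value v"
  by (induction u) (simp_all add: m_assoc)

lemma chain_value_neg: "chain_value (neg_chain u) = inv (chain_value u)"
  by (induction u)
    (auto simp: neg_chain_def int_pow_neg inv_mult_group commute)

lemma chain_value_add: "chain_value (add_chain u v) = chain_value u \<otimes> chain_value v"
proof (induction u v rule: add_chain.induct)
  case (3 c k u d l v)
  show ?case
  proof (cases "c = d")
    case True
    have "chain_value ((c, k) # u) \<otimes> chain_value ((d, l) # v) =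
        cell_value c [^] (k + l) \<otimes> (chain_value u \<otimes> chain_value v)"
      using True by (simp add: int_pow_mult commute_ac)
    with 3 True show ?thesis by (simp add: m_assoc)
  next
    case False
    with 3 show ?thesis by (auto simp: commute_ac)
  qed
qed auto

lemma chain_value_sort: "chain_value (sort_chain u) = chain_value u"
  by (induction u) (simp_all add: sort_chain_def chain_value_add)

lemma cell_value_translate:
  "cell_value (translate_cell a b c) = conjugate (transversal a b) (cell_value c)"
  by (cases c) (simp_all add: conjugate_transversal)

lemma chain_value_translate:
  "chain_value (translate_chain a b k u) = conjugate (transversal a b) (chain_value u) [^] k"
proof (induction u)
  case (Cons p u)
  have "cell_value (translate_cell a b (fst p)) [^] (k * snd p) =
      conjugate (transversal a b) (cell_value (fst p) [^] snd p) [^] k"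
    by (simp add: cell_value_translate conjugate_int_pow int_pow_pow mult.commute)
  with Cons show ?case
    by (simp add: translate_chain_def case_prod_unfold conjugate_mult int_pow_mult_in)
qed (simp add: translate_chain_def)

lemma chain_value_combination:
  assumes "\<And>u. u \<in> set us \<Longrightarrow> chain_value u = \<one>"
  shows "chain_value (chain_combination us cert) = \<one>"
proof -
  have inner: "chain_value (foldr (\<lambda>(a, b, k). add_chain (translate_chain a b k u)) ps acc) =
      chain_value acc" if "chain_value u = \<one>" for u ps acc
    using that by (induction ps) (auto simp: chain_value_add chain_value_translate)
  have "chain_value (foldr (\<lambda>(u, ps). foldr (\<lambda>(a, b, k). add_chain (translate_chain a b k u)) ps)
      ups []) = \<one>" if "\<And>u ps. (u, ps) \<in> set ups \<Longrightarrow> chain_value u = \<one>" for ups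
    using that by (induction ups) (force simp: inner)+
  then show ?thesis
    using assms unfolding chain_combination_def by (meson set_zip_leftD)
qed

text \<open>
  One equation for both signs of \<open>j\<close>: above the axis a square is added, below it one is removed.
\<close>

lemma chain_value_column_step:
  "chain_value (column i (j + 1)) = cell_value (Square i j) \<otimes> chain_value (column i j)"
proof (cases "j \<ge> 0")
  case True
  then have "[0..j] = [0..j - 1] @ [j]" by (simp add: upto_rec2)
  with True show ?thesis
    by (simp add: column_def chain_value_append commute_ac)
next
  case False
  then have "[j..-1] = j # [j + 1..-1]" by (simp add: upto_rec1)
  with False show ?thesis
    by (simp add: column_def chain_value_append int_pow_neg commute_ac)
qed

lemma transversal_t: 
  "transversal i j \<otimes> t = transversal i (j + 1)"
  "transversal i j \<otimes> inv t = transversal i (j - 1)"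
  by (simp_all add: transversal_def int_pow_mult int_pow_diff m_assoc)

lemma transversal_conjugate:
  "u \<in> H \<Longrightarrow> transversal i j \<otimes> u = conjugate (transversal i j) u \<otimes> transversal i j"
  by (simp add: conjugate_def m_assoc)

text \<open>
  Moving \<open>x\<close> past \<open>t\<^sup>j\<close> produces one commutator \<open>[t, x]\<close> for each step, conjugated into the column of
  squares between the edge and the axis.
\<close>

lemma transversal_x: "transversal i j \<otimes> x = chain_value (column i j) \<otimes> transversal (i + 1) j"
proof -
  have step: "transversal i (j + 1) \<otimes> x = cell_value (Square i j) \<otimes> (transversal i j \<otimes> x) \<otimes> t" for j
  proof -
    have "transversal i (j + 1) \<otimes> x = transversal i j \<otimes> (t \<otimes> x)"
      by (simp add: m_assoc flip: transversal_t)
    also have "t \<otimes> x = square \<otimes> (x \<otimes> t)"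
      by (simp add: square_def m_assoc)
    also have "transversal i j \<otimes> (square \<otimes> (x \<otimes> t)) = (transversal i j \<otimes> square) \<otimes> x \<otimes> t"
      by (simp add: m_assoc)
    finally show ?thesis by (simp add: transversal_conjugate m_assoc)
  qed
  \<comment> \<open>Multiplying by the square on the left and by \<open>t\<close> on the right is injective, so that
      the claim passes from \<open>j + 1\<close> to \<open>j\<close> as well.\<close>
  have iff: "transversal i (j + 1) \<otimes> x = chain_value (column i (j + 1)) \<otimes> transversal (i + 1) (j + 1)
      \<longleftrightarrow> transversal i j \<otimes> x = chain_value (column i j) \<otimes> transversal (i + 1) j" for j
  proof -
    have "chain_value (column i (j + 1)) \<otimes> transversal (i + 1) (j + 1) =
        cell_value (Square i j) \<otimes> (chain_value (column i j) \<otimes> transversal (i + 1) j) \<otimes> t"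
      by (simp add: chain_value_column_step m_assoc del: cell_value.simps flip: transversal_t)
    then show ?thesis
      unfolding step by (simp del: cell_value.simps)
  qed
  show ?thesis
  proof (induction j rule: int_induct[where k = 0])
    case base
    show ?case by (simp add: column_def transversal_def int_pow_mult)
  next
    case (step1 j)
    then show ?case using iff by simp
  next
    case (step2 j)
    then show ?case using iff[of "j - 1"] by simp
  qed
qed

lemma transversal_inv_x:
  "transversal i j \<otimes> inv x = inv (chain_value (column (i - 1) j)) \<otimes> transversal (i - 1) j"
proof -
  have "transversal (i - 1) j = chain_value (column (i - 1) j) \<otimes> transversal i j \<otimes> inv x"
    using transversal_x[of "i - 1" j] by (simp add: inv_solve_right)
  then show ?thesis by (simp add: m_assoc)
qed

primrec letter_value :: "letter \<Rightarrow> 'a" where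
  "letter_value Lx = x" | "letter_value Lt = t" | "letter_value Lf = f"

lemma letter_value_closed [simp]: "range letter_value \<subseteq> carrier G"
proof
  fix g assume "g \<in> range letter_value"
  then obtain l where "g = letter_value l" by blast
  then show "g \<in> carrier G" by (cases l) simp_all
qed

text \<open>
  Reidemeister-Schreier rewriting.  A word read from \<open>(i, j)\<close> ends at the vertex given by its exponents,
  and what it differs by from the transversal element of that vertex is the value of its chain.
\<close>

lemma transversal_word_value:
  "transversal i j \<otimes> word_value G letter_value w =
     chain_value (path_chain i j w) \<otimes>
       transversal (i + exponent_sum (\<lambda>l. of_bool (l = Lx)) w)
         (j + exponent_sum (\<lambda>l. of_bool (l = Lt)) w)"
proof (induction i j w rule: path_chain.induct)
  case (1 i j)
  show ?case by simp
next
  case (2 i j b w)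
  let ?v = "word_value G letter_value w"
  show ?case
  proof (cases b)
    case True
    have "transversal i j \<otimes> (x \<otimes> ?v) = transversal i j \<otimes> x \<otimes> ?v"
      by (simp add: m_assoc)
    also have "\<dots> = chain_value (column i j) \<otimes> (transversal (i + 1) j \<otimes> ?v)"
      by (simp add: transversal_x m_assoc)
    finally show ?thesis
      using 2(1) True by (simp add: chain_value_append m_assoc algebra_simps)
  next
    case False
    have "transversal i j \<otimes> (inv x \<otimes> ?v) = transversal i j \<otimes> inv x \<otimes> ?v"
      by (simp add: m_assoc)
    also have "\<dots> = chain_value (neg_chain (column (i - 1) j)) \<otimes> (transversal (i - 1) j \<otimes> ?v)"
      by (simp add: transversal_inv_x chain_value_neg m_assoc)
    finally show ?thesis
      using 2(2) False by (simp add: chain_value_append m_assoc algebra_simps)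
  qed
next
  case (3 i j b w)
  let ?v = "word_value G letter_value w"
  have "transversal i j \<otimes> (t \<otimes> ?v) = transversal i (j + 1) \<otimes> ?v"
      "transversal i j \<otimes> (inv t \<otimes> ?v) = transversal i (j - 1) \<otimes> ?v"
    by (simp_all add: m_assoc flip: transversal_t)
  with 3 show ?case by (auto simp: algebra_simps)
next
  case (4 i j b w)
  let ?v = "word_value G letter_value w"
  have "transversal i j \<otimes> (u \<otimes> ?v) = conjugate (transversal i j) u \<otimes> (transversal i j \<otimes> ?v)"
    if "u \<in> H" for u
    using that by (simp add: conjugate_def m_assoc)
  moreover have "conjugate (transversal i j) (inv f) = conjugate (transversal i j) f [^] (-1 :: int)"
    using conjugate_int_pow[of "transversal i j" f "-1"] by (simp add: int_pow_neg)
  ultimately show ?case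
    using 4 by (auto simp: m_assoc)
qed

end

section \<open>The relators of the Cartwright-Steger group as chains\<close>

text \<open>
  The inverse of the change of generators \<open>t = x\<^sup>3 y z\<close>, \<open>f = z t\<^sup>2 x\<close>: one has \<open>z = f x\<^sup>-\<^sup>1 t\<^sup>-\<^sup>2\<close> and
  \<open>y = x\<^sup>-\<^sup>3 t z\<^sup>-\<^sup>1 = x\<^sup>-\<^sup>3 t\<^sup>3 x f\<^sup>-\<^sup>1\<close>.
\<close>

fun lattice_word :: "cs_gen \<Rightarrow> letter word" where
  "lattice_word gx = [(Lx, True)]"
| "lattice_word gy = [(Lx, False), (Lx, False), (Lx, False), (Lt, True), (Lt, True), (Lt, True),
     (Lx, True), (Lf, False)]"
| "lattice_word gz = [(Lf, True), (Lx, False), (Lt, False), (Lt, False)]"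

definition relator_chain :: "(cs_gen \<times> int) list \<Rightarrow> chain" where
  "relator_chain r = sort_chain (path_chain 0 0 (substitute lattice_word (syllables_word r)))"

instance cs_gen :: finite
proof
  have "(UNIV :: cs_gen set) \<subseteq> {gx, gy, gz}"
    using cs_gen.exhaust by blast
  then show "finite (UNIV :: cs_gen set)"
    by (rule finite_subset) simp
qed

text \<open>
  The images of the generators in \<open>\<int>\<^sup>2\<close>: \<open>x \<mapsto> (1, 0)\<close>, \<open>y \<mapsto> (-2, 3)\<close>, \<open>z \<mapsto> (-1, -2)\<close>.
\<close>

definition first_coord :: "cs_gen \<Rightarrow> int" where
  "first_coord g = exponent_sum (\<lambda>l. of_bool (l = Lx)) (lattice_word g)"

definition second_coord :: "cs_gen \<Rightarrow> int" where
  "second_coord g = exponent_sum (\<lambda>l. of_bool (l = Lt)) (lattice_word g)"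

definition t_word :: "cs_gen word" where "t_word = syllables_word [(gx, 3), (gy, 1), (gz, 1)]"

definition f_word :: "cs_gen word" where
  "f_word = [(gz, True)] @ t_word @ t_word @ [(gx, True)]"

lemma exponent_sum_relators:
  assumes "r \<in> set cs_relators"
  shows "exponent_sum first_coord (syllables_word r) = 0"
    "exponent_sum second_coord (syllables_word r) = 0"
proof -
  have "list_all (\<lambda>r. exponent_sum first_coord (syllables_word r) = 0 \<and>
      exponent_sum second_coord (syllables_word r) = 0) cs_relators"
    by code_simp
  then show "exponent_sum first_coord (syllables_word r) = 0"
      "exponent_sum second_coord (syllables_word r) = 0"
    using assms by (auto simp: list_all_iff)
qed

text \<open>
  The exponents of the first relator are \<open>-7, -2, -3\<close> and cancel those of \<open>f\<close>.  This is why \<open>f\<close>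
  lies in the derived subgroup.
\<close>

lemma exponent_sum_f_word:
  "exponent_sum (\<lambda>k. of_bool (k = g)) (f_word @ syllables_word (cs_relators ! 0)) = 0"
  by (cases g; hypsubst; code_simp)

section \<open>Certificates of torsion\<close>

text \<open>
  The coefficients were found by linear algebra over the rational numbers: they solve the linear
  system for the translates of the relator chains that fit into a window of 12 by 15 cells (in the
  coordinates \<open>i\<close> and \<open>i + j\<close>), scaled by the common denominator 56.
\<close>

definition square_certificate :: "(int \<times> int \<times> int) list list" where
  "square_certificate = [
    [(-2, 6, 4), (-2, 7, 36), (-2, 8, -20), (-1, 4, -12), (-1, 5, -122), (-1, 6, 64),
     (-1, 7, 20), (0, 3, 18), (0, 4, -139), (0, 5, -172), (0, 6, 66), (1, 1, 120), (1, 2, -74),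
     (1, 3, -113), (1, 4, -244), (1, 5, -78), (2, 0, 179), (2, 1, -102), (2, 2, -32), (2, 3, -140)],
    [(3, -1, 56), (3, 1, -19), (3, 2, 180), (3, 3, -72), (4, -2, 96), (4, -1, -168), (4, 0, -39),
     (4, 1, 253), (4, 2, 68), (5, -3, -44), (5, -2, 18), (5, -1, -230), (5, 0, 182), (5, 1, 2),
     (6, -2, -34), (6, -1, -132), (6, 0, 52)],
    [(1, 1, -18), (1, 2, -62), (1, 3, 6), (1, 4, 124), (1, 5, -52), (2, 0, -98), (2, 1, -149),
     (2, 2, -156), (2, 3, 84), (2, 4, 128), (3, -1, 98), (3, 0, -130), (3, 1, -181), (3, 2, -40),
     (3, 3, 38), (4, -2, 34), (4, -1, 132), (4, 0, -52)],
    [(5, -1, -176), (5, 0, 53), (5, 1, -26), (5, 2, -48), (6, -2, 61), (6, -1, -141),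
     (6, 0, -84), (6, 1, -24), (7, -3, -142), (7, -2, 60), (7, -1, -140)],
    [(-1, 9, 108), (-1, 10, -120), (0, 8, 23), (0, 9, 44), (1, 7, -42), (1, 8, 2)],
    [(-1, 6, 74), (-1, 7, -114), (-1, 8, 44), (-1, 9, -62), (0, 4, 104), (0, 5, -28), (0, 6, 56),
     (0, 7, -138), (0, 8, 88), (1, 3, 95), (1, 4, -154), (1, 6, 2)],
    [(3, 2, -12), (3, 3, 32), (4, -1, 56), (4, 1, 18), (4, 2, -108), (5, -2, 96), (5, -1, -60),
     (5, 0, -22), (5, 1, -38), (6, -3, -44), (6, -2, 41), (6, -1, -186), (6, 0, -90),
     (7, -3, -42), (7, -2, -32), (7, -1, -88)],
    [(-1, 7, 16), (-1, 8, 20), (0, 5, 82), (0, 6, -64), (0, 7, -20), (1, 4, -103), (1, 5, 222),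
     (2, 5, 204), (3, 3, 54)],
    [],
    [],
    [(0, 5, 50)],
    []]"

definition loop_certificate :: "(int \<times> int \<times> int) list list" where
  "loop_certificate = [
    [(-5, 3, 22), (-5, 4, 12), (-5, 5, -70), (-4, 1, 30), (-4, 2, 40), (-4, 3, 86), (-4, 4, 78),
     (-3, -1, 28), (-3, 0, -6), (-3, 1, -106), (-3, 2, -33), (-3, 3, 120), (-2, -2, -28),
     (-2, -1, -62), (-2, 0, -104), (-2, 1, -39), (-2, 2, -32), (-1, -3, 86), (-1, -2, -113),
     (-1, -1, -26), (-1, 0, -34)],
    [(0, -3, 28), (0, -2, 52), (0, -1, 3), (0, 0, -90), (1, -5, 30), (1, -4, -68), (1, -3, 106),
     (1, -2, 109), (1, -1, 7), (2, -5, 28), (2, -4, -30), (2, -3, 148), (2, -2, -8), (3, -5, -4),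
     (3, -3, 32)],
    [(-2, -2, 24), (-2, -1, 16), (-2, 0, 80), (-2, 1, 60), (-2, 2, -32), (-1, -3, -78),
     (-1, -2, -60), (-1, -1, -9), (-1, 0, 104), (-1, 1, 110), (0, -4, 30), (0, -3, -116),
     (0, -2, -78), (0, -1, -23), (0, 0, 12), (1, -5, 4), (1, -3, -32)],
    [(2, -4, -110), (2, -3, 28), (2, -2, 47), (2, -1, 40), (3, -5, 16), (3, -4, -59),
     (3, -3, -11), (3, -2, -50), (4, -6, -136), (4, -5, -30), (4, -4, -34)],
    [(-4, 7, -50), (-3, 5, 8), (-3, 6, -15), (-2, 4, -42), (-2, 5, -8)],
    [(-4, 3, -24), (-4, 4, -98), (-4, 5, -8), (-4, 6, 10), (-3, 1, -50), (-3, 2, 32),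
     (-3, 3, -14), (-3, 4, -44), (-2, 0, -18), (-2, 1, -73), (-2, 2, -16), (-2, 3, -50)],
    [(0, -1, 30), (0, 0, -38), (1, -3, 28), (1, -2, -6), (1, -1, -32), (2, -5, 30), (2, -4, -68),
     (2, -3, 80), (2, -2, -12), (3, -5, 36), (3, -4, -45), (3, -3, -22), (4, -6, -42),
     (4, -5, -12)],
    [(-4, 3, 28), (-4, 4, 20), (-4, 5, 70), (-3, 2, -52), (-3, 3, -86), (-3, 4, -78),
     (-2, 1, 52), (-2, 2, 133), (-1, 2, 44), (0, 0, -16)],
    [],
    [],
    [(-4, 4, 28), (-3, 2, -6)],
    []]"

lemma square_certificate:
  "chain_combination (map relator_chain cs_relators) square_certificate = [(Square 0 0, 56)]"
  by code_simp

lemma loop_certificate: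
  "chain_combination (map relator_chain cs_relators) loop_certificate = [(Loop 0 0, 56)]"
  by code_simp

section \<open>Closed words in metabelian quotients\<close>

context abelian_normal
begin

text \<open>
  The relators are translated into chains of value 1, the certificates kill 56 times the two basic
  cells, translation kills 56 times every cell, and a word with trivial image in \<open>\<int>\<^sup>2\<close> has a value
  composed of cells only.
\<close>

proposition cs_word_pow_eq_one:
  fixes \<rho> :: "cs_gen \<Rightarrow> 'a"
  assumes quotient: "comm_group (G Mod H)" and \<rho>: "range \<rho> \<subseteq> carrier G"
    and relators: "\<And>r. r \<in> set cs_relators \<Longrightarrow> word_value G \<rho> (syllables_word r) = \<one>"
    and w: "exponent_sum first_coord w = 0" "exponent_sum second_coord w = 0"
  shows "word_value G \<rho> w [^] (56 :: int) = \<one>"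
proof -
  have [simp]: "\<rho> g \<in> carrier G" for g
    using \<rho> by blast
  interpret M: comm_group "G Mod H" by fact
  interpret p: group_hom G "G Mod H" "\<lambda>g. H #> g"
    by (intro group_hom.intro group_hom_axioms.intro is_group M.is_group r_coset_hom_Mod)
  have range: "range ((\<lambda>g. H #> g) \<circ> \<rho>) \<subseteq> carrier (G Mod H)"
    by (auto intro!: p.hom_closed)
  define t where "t = word_value G \<rho> t_word"
  define f where "f = word_value G \<rho> f_word"
  have t_eq: "t = \<rho> gx \<otimes> (\<rho> gx \<otimes> (\<rho> gx \<otimes> (\<rho> gy \<otimes> \<rho> gz)))"
    by (simp add: t_def t_word_def syllables_word_def numeral_eq_Suc)
  have f_eq: "f = \<rho> gz \<otimes> (t \<otimes> (t \<otimes> \<rho> gx))"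
    using \<rho> by (simp add: f_def f_word_def t_def word_value_append m_assoc)
  have t_in: "t \<in> carrier G" and f_in: "f \<in> carrier G"
    using \<rho> by (simp_all add: t_def f_def)
  have "f = word_value G \<rho> (f_word @ syllables_word (cs_relators ! 0))"
    using \<rho> f_in relators[of "cs_relators ! 0"]
    by (simp add: word_value_append f_def[symmetric] cs_relators_def)
  then have "H #> f =
      word_value (G Mod H) ((\<lambda>g. H #> g) \<circ> \<rho>) (f_word @ syllables_word (cs_relators ! 0))"
    using p.word_value_hom[OF \<rho>] by simp
  also have "\<dots> = H"
    using M.word_value_eq_one[OF range exponent_sum_f_word] by simp
  finally have "f \<in> H"
    using f_in is_subgroup coset_join1 by blast
  moreover have "H #> (t \<otimes> \<rho> gx) = H #> (\<rho> gx \<otimes> t)"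
    using p.hom_mult[of t "\<rho> gx"] p.hom_mult[of "\<rho> gx" t] M.m_comm[of "H #> t" "H #> \<rho> gx"] t_in
    by (simp add: p.hom_closed[simplified])
  ultimately interpret L: lattice_transversal H G "\<rho> gx" t f
    by unfold_locales (simp_all add: t_in)
  have gen: "word_value G L.letter_value (lattice_word g) = \<rho> g" for g
  proof (cases g)
    case gx
    then show ?thesis by simp
  next
    case gy
    have "word_value G L.letter_value (lattice_word gy) =
        inv \<rho> gx \<otimes> (inv \<rho> gx \<otimes> (inv \<rho> gx \<otimes> (t \<otimes> (t \<otimes> (t \<otimes> (\<rho> gx \<otimes> inv f))))))"
      using f_in by simp
    also have "\<dots> = inv \<rho> gx \<otimes> (inv \<rho> gx \<otimes> (inv \<rho> gx \<otimes> (t \<otimes> inv \<rho> gz)))"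
      using t_in by (simp add: f_eq inv_mult_group m_assoc)
    also have "\<dots> = \<rho> gy"
      by (simp add: t_eq m_assoc)
    finally show ?thesis by (simp add: gy)
  next
    case gz
    have "word_value G L.letter_value (lattice_word gz) = f \<otimes> (inv \<rho> gx \<otimes> (inv t \<otimes> inv t))"
      using t_in by simp
    also have "\<dots> = \<rho> gz"
      using t_in by (simp add: f_eq m_assoc)
    finally show ?thesis by (simp add: gz)
  qed
  have normal_form: "word_value G \<rho> u = L.chain_value (path_chain 0 0 (substitute lattice_word u))"
    if "exponent_sum first_coord u = 0" "exponent_sum second_coord u = 0" for u
  proof -
    have "word_value G \<rho> u =
        L.transversal 0 0 \<otimes> word_value G L.letter_value (substitute lattice_word u)"
      using \<rho>
      by (simp add: L.transversal_def word_value_substitute[OF L.letter_value_closed gen])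
    also have "\<dots> = L.chain_value (path_chain 0 0 (substitute lattice_word u)) \<otimes> L.transversal 0 0"
      using that unfolding L.transversal_word_value
      by (simp add: exponent_sum_substitute flip: first_coord_def second_coord_def)
    finally show ?thesis by (simp add: L.transversal_def)
  qed
  have "L.chain_value u = \<one>" if "u \<in> set (map relator_chain cs_relators)" for u
    using that relators normal_form[of "syllables_word r" for r]
    by (auto simp: relator_chain_def L.chain_value_sort exponent_sum_relators)
  then have "L.chain_value (chain_combination (map relator_chain cs_relators) cert) = \<one>" for cert
    by (rule L.chain_value_combination)
  from this[of square_certificate] this[of loop_certificate]
  have "L.chain_value [(Square 0 0, 56)] = \<one>" "L.chain_value [(Loop 0 0, 56)] = \<one>"
    unfolding square_certificate loop_certificate by blast+
  then have "L.square [^] (56 :: int) = \<one>" "f [^] (56 :: int) = \<one>"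
    by (simp_all add: L.transversal_def)
  then have cell: "L.cell_value c [^] (56 :: int) = \<one>" for c
    by (cases c) (simp_all flip: conjugate_int_pow)
  have "L.chain_value u [^] (56 :: int) = \<one>" for u
  proof (induction u)
    case (Cons p u)
    have "(L.cell_value (fst p) [^] snd p) [^] (56 :: int) =
        (L.cell_value (fst p) [^] (56 :: int)) [^] snd p"
      by (simp add: int_pow_pow mult.commute)
    with Cons show ?case
      by (simp add: int_pow_mult_in cell)
  qed simp
  then show ?thesis
    by (simp add: normal_form w)
qed

end

section \<open>Homomorphisms to the integers\<close>

lemma word_value_presented_group:
  "word_value (presented_group R) (\<lambda>g. word_rel R `` {[(g, True)]}) w = word_rel R `` {w}"
proof (induction w)
  case Nil
  show ?case by (simp add: presented_group_def)
next
  case (Cons l w)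
  interpret P: group "presented_group R" by (rule group_presented_group)
  have closed: "word_rel R `` {u} \<in> carrier (presented_group R)" for u
    by (simp add: presented_group_def quotientI)
  have "word_rel R `` {[(g, False)] @ [(g, True)]} = word_rel R `` {[]}" for g
    using word_equiv.cancel[of R "[]" g False "[]"]
    by (intro equiv_class_eq[OF equiv_word_rel]) (simp add: word_rel_def)
  then have "inv\<^bsub>presented_group R\<^esub> (word_rel R `` {[(g, True)]}) = word_rel R `` {[(g, False)]}" for g
    by (intro P.inv_equality closed) (simp_all only: presented_group_mult,
        simp add: presented_group_def)
  then show ?case
    by (cases l) (auto simp: Cons presented_group_mult)
qed

text \<open>
  A group isomorphic to a presented one is described inside itself: by the values of generators, and
  by the words that become equal there.
\<close>

lemma presented_group_iso_generators:
  assumes "group \<Gamma>" "\<Gamma> \<cong> presented_group R"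
  obtains \<rho> where "range \<rho> \<subseteq> carrier \<Gamma>" "carrier \<Gamma> = range (word_value \<Gamma> \<rho>)"
    "\<And>u v. word_value \<Gamma> \<rho> u = word_value \<Gamma> \<rho> v \<longleftrightarrow> word_equiv R u v"
proof -
  obtain k where k: "k \<in> iso (presented_group R) \<Gamma>"
    using assms group.iso_sym by (auto simp: is_iso_def)
  interpret k: group_hom "presented_group R" \<Gamma> k
    using k by (intro group_hom.intro group_hom_axioms.intro group_presented_group assms(1))
      (simp add: iso_def)
  let ?class = "\<lambda>w. word_rel R `` {w}"
  have carrier: "carrier (presented_group R) = range ?class"
    by (auto simp: presented_group_def quotient_def)
  let ?\<rho> = "k \<circ> (\<lambda>g. ?class [(g, True)])"
  have val: "word_value \<Gamma> ?\<rho> w = k (?class w)" for w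
    using k.word_value_hom[of "\<lambda>g. ?class [(g, True)]" w]
    by (simp add: word_value_presented_group carrier image_subset_iff)
  have bij: "bij_betw k (range ?class) (carrier \<Gamma>)"
    using k carrier by (simp add: iso_def)
  show thesis
  proof
    show "range ?\<rho> \<subseteq> carrier \<Gamma>"
      using bij by (auto simp: bij_betw_def)
    show "carrier \<Gamma> = range (word_value \<Gamma> ?\<rho>)"
      using bij unfolding val[abs_def] by (auto simp: bij_betw_def image_image)
    show "word_value \<Gamma> ?\<rho> u = word_value \<Gamma> ?\<rho> v \<longleftrightarrow> word_equiv R u v" for u v
    proof -
      have "word_value \<Gamma> ?\<rho> u = word_value \<Gamma> ?\<rho> v \<longleftrightarrow> ?class u = ?class v"
        unfolding val using bij_betw_imp_inj_on[OF bij] by (rule inj_on_eq_iff) simp_all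
      also have "\<dots> \<longleftrightarrow> (u, v) \<in> word_rel R"
        by (rule eq_equiv_class_iff[OF equiv_word_rel]) simp_all
      finally show ?thesis by (simp add: word_rel_def)
    qed
  qed
qed

text \<open>
  The quotient by the second derived subgroup is metabelian: its derived subgroup is the image of
  the derived subgroup, whose commutators have been killed.
\<close>

lemma (in group) abelian_normal_derived_quotient:
  defines "D \<equiv> derived G (derived G (carrier G))"
  shows "abelian_normal (derived (G Mod D) (carrier (G Mod D))) (G Mod D)"
proof -
  interpret D: normal D G
    unfolding D_def by (intro derived_is_normal normal_self)
  interpret Q: group "G Mod D" by (rule D.factorgroup_is_group)
  interpret p: group_hom G "G Mod D" "\<lambda>g. D #> g"
    by (intro group_hom.intro group_hom_axioms.intro is_group Q.is_group D.r_coset_hom_Mod)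
  let ?N = "derived (G Mod D) (carrier (G Mod D))"
  interpret N: normal ?N "G Mod D" by (rule Q.derived_self_is_normal)
  have "?N = (\<lambda>g. D #> g) ` derived G (carrier G)"
    using p.derived_img[of "carrier G"] by (simp add: carrier_FactGroup)
  then have "derived (G Mod D) ?N = (\<lambda>g. D #> g) ` D"
    using p.derived_img[of "derived G (carrier G)"] derived_in_carrier[of "carrier G"]
    by (simp add: D_def)
  then have trivial: "derived (G Mod D) ?N \<subseteq> {\<one>\<^bsub>G Mod D\<^esub>}"
    using coset_join2[OF _ D.is_subgroup] by auto
  show ?thesis
  proof
    fix u v assume uv: "u \<in> ?N" "v \<in> ?N"
    then have "u \<otimes>\<^bsub>G Mod D\<^esub> v \<otimes>\<^bsub>G Mod D\<^esub> inv\<^bsub>G Mod D\<^esub> u \<otimes>\<^bsub>G Mod D\<^esub> inv\<^bsub>G Mod D\<^esub> v \<in> derived (G Mod D) ?N"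
      unfolding derived_def by (intro generate.incl) blast
    with trivial have "u \<otimes>\<^bsub>G Mod D\<^esub> v \<otimes>\<^bsub>G Mod D\<^esub> inv\<^bsub>G Mod D\<^esub> u \<otimes>\<^bsub>G Mod D\<^esub> inv\<^bsub>G Mod D\<^esub> v = \<one>\<^bsub>G Mod D\<^esub>"
      by blast
    moreover have "u \<in> carrier (G Mod D)" "v \<in> carrier (G Mod D)"
      using uv N.mem_carrier by blast+
    ultimately show "u \<otimes>\<^bsub>G Mod D\<^esub> v = v \<otimes>\<^bsub>G Mod D\<^esub> u"
      by (metis Q.inv_closed Q.inv_solve_right Q.l_one Q.m_closed Q.inv_solve_right')
  qed
qed

text \<open>
  The coordinates of the abelianization \<open>\<int>\<^sup>2\<close>, with preimages of its basis.  An element that both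
  coordinates kill is the value of a word whose path in the grid is closed; this is why its 56th
  power dies in \<open>\<Gamma>/\<Gamma>''\<close>.
\<close>

proposition cartwright_steger_homs:
  assumes "group \<Gamma>" "\<Gamma> \<cong> cartwright_steger_group"
  obtains \<phi> \<psi> a b where "\<phi> \<in> hom \<Gamma> integer_group" "\<psi> \<in> hom \<Gamma> integer_group"
    "a \<in> carrier \<Gamma>" "b \<in> carrier \<Gamma>" "\<phi> a = 1" "\<psi> a = 0" "\<phi> b = 0" "\<psi> b = 1"
    "\<And>g. \<lbrakk>g \<in> carrier \<Gamma>; \<phi> g = 0; \<psi> g = 0\<rbrakk> \<Longrightarrow>
       g [^]\<^bsub>\<Gamma>\<^esub> (56 :: int) \<in> derived \<Gamma> (derived \<Gamma> (carrier \<Gamma>))"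
proof -
  interpret group \<Gamma> by fact
  let ?R = "set (map syllables_word cs_relators)"
  obtain \<rho> where \<rho>: "range \<rho> \<subseteq> carrier \<Gamma>" "carrier \<Gamma> = range (word_value \<Gamma> \<rho>)"
    and eq_iff: "\<And>u v. word_value \<Gamma> \<rho> u = word_value \<Gamma> \<rho> v \<longleftrightarrow> word_equiv ?R u v"
    using presented_group_iso_generators[OF assms[unfolded cartwright_steger_group_def]] by blast
  have "\<exists>\<chi> \<in> hom \<Gamma> integer_group. \<forall>w. \<chi> (word_value \<Gamma> \<rho> w) = exponent_sum d w"
    if d: "\<And>r. r \<in> set cs_relators \<Longrightarrow> exponent_sum d (syllables_word r) = 0" for d
  proof -
    \<comment> \<open>The exponent sum of a word depends only on its value, since it vanishes on the relators.\<close>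
    define \<chi> where "\<chi> g = exponent_sum d (SOME w. word_value \<Gamma> \<rho> w = g)" for g
    have \<chi>: "\<chi> (word_value \<Gamma> \<rho> w) = exponent_sum d w" for w
    proof -
      have "word_value \<Gamma> \<rho> (SOME u. word_value \<Gamma> \<rho> u = word_value \<Gamma> \<rho> w) = word_value \<Gamma> \<rho> w"
        by (rule someI_ex) blast
      then show ?thesis
        unfolding \<chi>_def by (intro exponent_sum_word_equiv[of ?R]) (auto simp: eq_iff d)
    qed
    moreover have "\<chi> \<in> hom \<Gamma> integer_group"
    proof (rule homI)
      fix g h assume "g \<in> carrier \<Gamma>" "h \<in> carrier \<Gamma>"
      then obtain u v where "g = word_value \<Gamma> \<rho> u" "h = word_value \<Gamma> \<rho> v"
        using \<rho>(2) by auto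
      then show "\<chi> (g \<otimes>\<^bsub>\<Gamma>\<^esub> h) = \<chi> g \<otimes>\<^bsub>integer_group\<^esub> \<chi> h"
        by (simp add: \<chi> flip: word_value_append[OF \<rho>(1)])
    qed simp
    ultimately show ?thesis by blast
  qed
  from this[of first_coord] this[of second_coord] obtain \<phi> \<psi>
    where hom: "\<phi> \<in> hom \<Gamma> integer_group" "\<psi> \<in> hom \<Gamma> integer_group"
    and \<phi>: "\<And>w. \<phi> (word_value \<Gamma> \<rho> w) = exponent_sum first_coord w"
    and \<psi>: "\<And>w. \<psi> (word_value \<Gamma> \<rho> w) = exponent_sum second_coord w"
    using exponent_sum_relators by metis
  let ?D = "derived \<Gamma> (derived \<Gamma> (carrier \<Gamma>))"
  interpret D: normal ?D \<Gamma>
    by (intro derived_is_normal normal_self)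
  interpret Q: group "\<Gamma> Mod ?D" by (rule D.factorgroup_is_group)
  interpret p: group_hom \<Gamma> "\<Gamma> Mod ?D" "\<lambda>g. ?D #>\<^bsub>\<Gamma>\<^esub> g"
    by (intro group_hom.intro group_hom_axioms.intro is_group Q.is_group D.r_coset_hom_Mod)
  interpret N: abelian_normal "derived (\<Gamma> Mod ?D) (carrier (\<Gamma> Mod ?D))" "\<Gamma> Mod ?D"
    by (rule abelian_normal_derived_quotient)
  have torsion: "g [^]\<^bsub>\<Gamma>\<^esub> (56 :: int) \<in> ?D" if g: "g \<in> carrier \<Gamma>" "\<phi> g = 0" "\<psi> g = 0" for g
  proof -
    obtain w where w: "g = word_value \<Gamma> \<rho> w"
      using g \<rho>(2) by auto
    let ?\<rho> = "(\<lambda>g. ?D #>\<^bsub>\<Gamma>\<^esub> g) \<circ> \<rho>"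
    have range: "range ?\<rho> \<subseteq> carrier (\<Gamma> Mod ?D)"
      using \<rho>(1) by (auto intro!: p.hom_closed)
    have "word_value \<Gamma> \<rho> (syllables_word r) = \<one>\<^bsub>\<Gamma>\<^esub>" if "r \<in> set cs_relators" for r
    proof -
      have "word_equiv ?R ([] @ syllables_word r @ []) ([] @ [])"
        using that by (intro word_equiv.relator) simp
      then show ?thesis
        using eq_iff[of "syllables_word r" "[]"] by simp
    qed
    then have "word_value (\<Gamma> Mod ?D) ?\<rho> w [^]\<^bsub>\<Gamma> Mod ?D\<^esub> (56 :: int) = \<one>\<^bsub>\<Gamma> Mod ?D\<^esub>"
      using g w \<phi> \<psi>
      by (intro N.cs_word_pow_eq_one Q.derived_quot_is_comm_group range)
        (simp_all flip: p.word_value_hom[OF \<rho>(1)])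
    then have "?D #>\<^bsub>\<Gamma>\<^esub> (g [^]\<^bsub>\<Gamma>\<^esub> (56 :: int)) = ?D"
      using g by (simp add: w flip: p.word_value_hom[OF \<rho>(1)] D.FactGroup_int_pow)
    then show ?thesis
      using g coset_join1 D.is_subgroup int_pow_closed by blast
  qed
  have "exponent_sum first_coord [(gx, True)] = 1 \<and> exponent_sum second_coord [(gx, True)] = 0 \<and>
      exponent_sum first_coord t_word = 0 \<and> exponent_sum second_coord t_word = 1"
    by code_simp
  with hom torsion show thesis
    using \<rho>(1) by (intro that[of \<phi> \<psi> "word_value \<Gamma> \<rho> [(gx, True)]" "word_value \<Gamma> \<rho> t_word"])
      (simp_all only: \<phi> \<psi> word_value_closed)
qed

section \<open>First Betti numbers equal to two\<close>

text \<open>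
  Three vectors \<open>(p i, q i)\<close> in the plane.  Their \<open>2 \<times> 2\<close> minors give a relation, unless all vanish;
  then already the first two vectors, or the first one alone, are dependent.
\<close>

lemma ex_integer_relation:
  fixes p q :: "nat \<Rightarrow> int"
  shows "\<exists>m :: nat \<Rightarrow> int. (m 0 \<noteq> 0 \<or> m 1 \<noteq> 0 \<or> m 2 \<noteq> 0) \<and>
    m 0 * p 0 + m 1 * p 1 + m 2 * p 2 = 0 \<and> m 0 * q 0 + m 1 * q 1 + m 2 * q 2 = 0"
proof -
  have wit: ?thesis
    if "a \<noteq> 0 \<or> b \<noteq> 0 \<or> c \<noteq> 0" "a * p 0 + b * p 1 + c * p 2 = 0"
      "a * q 0 + b * q 1 + c * q 2 = 0" for a b c
    using that by (intro exI[of _ "\<lambda>i. if i = 0 then a else if i = 1 then b else c"]) simp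
  let ?d = "\<lambda>i j. p i * q j - p j * q i"
  consider "?d 1 2 \<noteq> 0 \<or> ?d 2 0 \<noteq> 0 \<or> ?d 0 1 \<noteq> 0" | "p 0 \<noteq> 0" "?d 0 1 = 0"
    | "q 0 \<noteq> 0" "?d 0 1 = 0" | "p 0 = 0" "q 0 = 0"
    by auto
  then show ?thesis
  proof cases
    case 1
    then show ?thesis by (intro wit[of "?d 1 2" "?d 2 0" "?d 0 1"]) (simp_all add: algebra_simps)
  next
    case 2
    then show ?thesis by (intro wit[of "- p 1" "p 0" 0]) (simp_all add: algebra_simps)
  next
    case 3
    then show ?thesis by (intro wit[of "- q 1" "q 0" 0]) (simp_all add: algebra_simps)
  next
    case 4
    then show ?thesis by (intro wit[of 1 0 0]) simp_all
  qed
qed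

lemma comm_group_rat_group: "comm_group rat_group"
  unfolding rat_group_def
  by (rule comm_groupI) (auto intro: exI[of _ "- x" for x])

lemma rat_group_simps [simp]:
  "carrier rat_group = UNIV" "p \<otimes>\<^bsub>rat_group\<^esub> q = p + q" "\<one>\<^bsub>rat_group\<^esub> = 0"
  by (simp_all add: rat_group_def)

context comm_group
begin

abbreviation (input) free_pairs :: "('a \<times> rat \<Rightarrow>\<^sub>0 int) monoid" where
  "free_pairs \<equiv> free_Abelian_group (carrier G \<times> UNIV)"

definition bilinear_span :: "('a \<times> rat \<Rightarrow>\<^sub>0 int) set" where
  "bilinear_span = generate free_pairs (tensor_relations G rat_group)"

definition pure :: "'a \<Rightarrow> rat \<Rightarrow> ('a \<times> rat \<Rightarrow>\<^sub>0 int) set" where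
  "pure a q = bilinear_span #>\<^bsub>free_pairs\<^esub> frag_of (a, q)"

lemma tensor_eq: "tensor_product G rat_group = free_pairs Mod bilinear_span"
  by (simp add: tensor_product_def bilinear_span_def Let_def)

lemma keys_diff3: "Poly_Mapping.keys (a - b - c :: 'x \<Rightarrow>\<^sub>0 int) \<subseteq> S"
  if "Poly_Mapping.keys a \<subseteq> S" "Poly_Mapping.keys b \<subseteq> S" "Poly_Mapping.keys c \<subseteq> S"
  using that keys_diff[of "a - b" c] keys_diff[of a b] by blast

lemma tensor_relations_closed: "tensor_relations G rat_group \<subseteq> carrier free_pairs"
  by (auto simp: tensor_relations_def simp del: carrier_free_Abelian_group_iff
      intro!: keys_diff3[THEN carrier_free_Abelian_group_iff[THEN iffD2]])

lemma bilinear_span_normal: "bilinear_span \<lhd> free_pairs"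
proof -
  interpret F: comm_group free_pairs by (rule abelian_free_Abelian_group)
  show ?thesis
    unfolding bilinear_span_def
    by (rule F.subgroup_imp_normal[OF F.generate_is_subgroup[OF tensor_relations_closed]])
qed

lemma comm_group_tensor: "comm_group (tensor_product G rat_group)"
proof -
  interpret F: comm_group free_pairs by (rule abelian_free_Abelian_group)
  show ?thesis
    unfolding tensor_eq
    by (rule F.abelian_FactGroup[OF normal_imp_subgroup[OF bilinear_span_normal]])
qed

lemma pure_closed [simp]: "a \<in> carrier G \<Longrightarrow> pure a q \<in> carrier (tensor_product G rat_group)"
  by (simp add: tensor_eq pure_def carrier_FactGroup)

lemma coset_eq_if_diff:
  assumes "u - v \<in> bilinear_span" "u \<in> carrier free_pairs" "v \<in> carrier free_pairs"
  shows "bilinear_span #>\<^bsub>free_pairs\<^esub> u = bilinear_span #>\<^bsub>free_pairs\<^esub> v"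
proof -
  interpret F: normal bilinear_span free_pairs by (rule bilinear_span_normal)
  have "u \<in> bilinear_span #>\<^bsub>free_pairs\<^esub> v"
    using assms(1) by (force simp: r_coset_def)
  then show ?thesis
    using F.repr_independence assms(3) F.is_subgroup by metis
qed

lemma coset_add:
  assumes "u \<in> carrier free_pairs" "v \<in> carrier free_pairs"
  shows "(bilinear_span #>\<^bsub>free_pairs\<^esub> u) \<otimes>\<^bsub>tensor_product G rat_group\<^esub>
    (bilinear_span #>\<^bsub>free_pairs\<^esub> v) = bilinear_span #>\<^bsub>free_pairs\<^esub> (u + v)"
  using normal.rcos_sum[OF bilinear_span_normal assms] by (simp add: tensor_eq)

lemma pure_mult_left:
  assumes "a \<in> carrier G" "b \<in> carrier G"
  shows "pure (a \<otimes> b) q = pure a q \<otimes>\<^bsub>tensor_product G rat_group\<^esub> pure b q"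
proof -
  have "frag_of (a \<otimes> b, q) - frag_of (a, q) - frag_of (b, q) \<in> bilinear_span"
    unfolding bilinear_span_def
    by (rule generate.incl) (use assms in \<open>force simp: tensor_relations_def\<close>)
  then have "pure (a \<otimes> b) q = bilinear_span #>\<^bsub>free_pairs\<^esub> (frag_of (a, q) + frag_of (b, q))"
    unfolding pure_def using assms keys_add[of "frag_of (a, q)" "frag_of (b, q)"]
    by (intro coset_eq_if_diff) (auto simp: diff_diff_eq)
  also have "\<dots> = pure a q \<otimes>\<^bsub>tensor_product G rat_group\<^esub> pure b q"
    unfolding pure_def using assms by (intro coset_add[symmetric]) simp_all
  finally show ?thesis .
qed

lemma pure_add_right:
  assumes "a \<in> carrier G"
  shows "pure a (p + q) = pure a p \<otimes>\<^bsub>tensor_product G rat_group\<^esub> pure a q"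
proof -
  have "frag_of (a, p + q) - frag_of (a, p) - frag_of (a, q) \<in> bilinear_span"
    unfolding bilinear_span_def
    by (rule generate.incl) (use assms in \<open>force simp: tensor_relations_def\<close>)
  then have "pure a (p + q) = bilinear_span #>\<^bsub>free_pairs\<^esub> (frag_of (a, p) + frag_of (a, q))"
    unfolding pure_def using assms keys_add[of "frag_of (a, p)" "frag_of (a, q)"]
    by (intro coset_eq_if_diff) (auto simp: diff_diff_eq)
  also have "\<dots> = pure a p \<otimes>\<^bsub>tensor_product G rat_group\<^esub> pure a q"
    unfolding pure_def using assms by (intro coset_add[symmetric]) simp_all
  finally show ?thesis .
qed

lemma pure_int_pow_left:
  assumes "a \<in> carrier G"
  shows "pure (a [^] (n :: int)) q = pure a q [^]\<^bsub>tensor_product G rat_group\<^esub> n"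
proof -
  interpret T: comm_group "tensor_product G rat_group" by (rule comm_group_tensor)
  interpret h: group_hom G "tensor_product G rat_group" "\<lambda>a. pure a q"
    by (intro group_hom.intro group_hom_axioms.intro is_group T.is_group homI)
      (simp_all add: pure_mult_left)
  show ?thesis by (rule h.hom_int_pow[OF assms])
qed

lemma pure_int_pow_right:
  assumes "a \<in> carrier G"
  shows "pure a (of_int n * q) = pure a q [^]\<^bsub>tensor_product G rat_group\<^esub> n"
proof -
  interpret T: comm_group "tensor_product G rat_group" by (rule comm_group_tensor)
  interpret h: group_hom integer_group "tensor_product G rat_group" "\<lambda>n. pure a (of_int n * q)"
    by (intro group_hom.intro group_hom_axioms.intro T.is_group homI)
      (simp_all add: assms distrib_right pure_add_right)
  show ?thesis using h.hom_int_pow[of 1 n] by simp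
qed

lemma pure_one_left [simp]: "pure \<one> q = \<one>\<^bsub>tensor_product G rat_group\<^esub>"
  using pure_int_pow_left[of \<one> 0 q] by simp

text \<open>
  Common denominators: in a tensor product with the rationals, all integers are pulled over to the
  left factor, after which sums of pure tensors are pure.
\<close>

lemma tensor_pure:
  assumes "\<tau> \<in> carrier (tensor_product G rat_group)"
  obtains a d where "a \<in> carrier G" "d > 0" "\<tau> = pure a (1 / of_int d)"
proof -
  interpret T: comm_group "tensor_product G rat_group" by (rule comm_group_tensor)
  let ?coset = "\<lambda>c. bilinear_span #>\<^bsub>free_pairs\<^esub> c"
  have scale: "pure a (1 / of_int d) = pure (a [^] k) (1 / of_int (d * k))"
    if "a \<in> carrier G" "k > 0" for a d k
    using that pure_int_pow_right[of a k "1 / of_int (d * k)"]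
    by (simp add: pure_int_pow_left)
  have "\<exists>a d. a \<in> carrier G \<and> d > 0 \<and> ?coset c = pure a (1 / of_int d)"
    if "Poly_Mapping.keys c \<subseteq> carrier G \<times> UNIV" for c
  proof -
    from that have "Poly_Mapping.keys c \<subseteq> carrier G \<times> UNIV \<and>
      (\<exists>a d. a \<in> carrier G \<and> d > 0 \<and> ?coset c = pure a (1 / of_int d))"
    proof (induction rule: frag_induction)
      case zero
      have "?coset 0 = \<one>\<^bsub>tensor_product G rat_group\<^esub>"
        using group.coset_mult_one[OF group_free_Abelian_group, of bilinear_span]
          subgroup.subset[OF normal_imp_subgroup[OF bilinear_span_normal]]
        by (simp add: tensor_eq)
      then show ?case
        by (intro conjI exI[of _ \<one>] exI[of _ 1]) simp_all
    next
      case (one p)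
      obtain b q where p: "p = (b, q)" "b \<in> carrier G" using one by auto
      obtain n d where nd: "q = of_int n / of_int d" "d > 0"
        by (metis Rat_cases Fract_of_int_quotient)
      have "?coset (frag_of p) = pure b (of_int n * (1 / of_int d))"
        by (simp add: pure_def p nd)
      also have "\<dots> = pure (b [^] n) (1 / of_int d)"
        using p by (simp only: pure_int_pow_right pure_int_pow_left)
      finally show ?case using p nd by auto
    next
      case (diff c c')
      then obtain a d a' d' where a: "a \<in> carrier G" "d > 0" "?coset c = pure a (1 / of_int d)"
        and a': "a' \<in> carrier G" "d' > 0" "?coset c' = pure a' (1 / of_int d')" by auto
      have keys: "Poly_Mapping.keys (c - c') \<subseteq> carrier G \<times> UNIV"
        using diff keys_diff[of c c'] by blast
      let ?b = "a [^] d' \<otimes> inv (a' [^] d)"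
      have "?coset (c - c') \<otimes>\<^bsub>tensor_product G rat_group\<^esub> ?coset c' = ?coset c"
        using keys diff by (simp add: coset_add)
      moreover have "pure ?b (1 / of_int (d * d')) \<otimes>\<^bsub>tensor_product G rat_group\<^esub> ?coset c' = ?coset c"
        using a a' scale[of a d' d] scale[of a' d d']
        by (simp add: mult.commute m_assoc flip: pure_mult_left)
      moreover have "?coset (c - c') \<in> carrier (tensor_product G rat_group)"
        "?coset c' \<in> carrier (tensor_product G rat_group)"
        using keys diff by (auto simp: tensor_eq carrier_FactGroup)
      ultimately have "?coset (c - c') = pure ?b (1 / of_int (d * d'))"
        using a a' by (metis T.r_cancel inv_closed int_pow_closed m_closed pure_closed)
      with keys a a' show ?case
        by (intro conjI exI[of _ ?b] exI[of _ "d * d'"]) auto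
    qed
    then show ?thesis by blast
  qed
  moreover obtain c where "Poly_Mapping.keys c \<subseteq> carrier G \<times> UNIV" "\<tau> = ?coset c"
    using assms by (auto simp: tensor_eq carrier_FactGroup)
  ultimately show thesis
    using that by metis
qed

text \<open>
  The functional \<open>a \<otimes> q \<mapsto> \<phi> a * q\<close>, obtained from the universal property of the free abelian
  group on pairs, since it is bilinear.
\<close>

lemma tensor_hom:
  assumes "\<phi> \<in> hom G integer_group"
  obtains \<Phi> where "\<Phi> \<in> hom (tensor_product G rat_group) rat_group"
    "\<And>a q. a \<in> carrier G \<Longrightarrow> \<Phi> (pure a q) = of_int (\<phi> a) * q"
proof -
  interpret F: normal bilinear_span free_pairs by (rule bilinear_span_normal)
  obtain h where h: "h \<in> hom free_pairs rat_group"
    and h_of: "\<And>p. p \<in> carrier G \<times> UNIV \<Longrightarrow> h (frag_of p) = of_int (\<phi> (fst p)) * snd p"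
    by (rule comm_group.free_Abelian_group_universal[OF comm_group_rat_group,
          of "\<lambda>p. of_int (\<phi> (fst p)) * snd p" "carrier G \<times> UNIV"]) auto
  interpret h: group_hom free_pairs rat_group h
    using h comm_group_rat_group
    by (intro group_hom.intro group_hom_axioms.intro F.is_group) (simp_all add: comm_group_def)
  have diff: "h (u - v) = h u - h v" if "u \<in> carrier free_pairs" "v \<in> carrier free_pairs" for u v
  proof -
    have "u - v \<in> carrier free_pairs"
      using that keys_diff[of u v] by auto
    then show ?thesis
      using h.hom_mult[of "u - v" v] that by simp
  qed
  have \<phi>: "\<phi> (a \<otimes> b) = \<phi> a + \<phi> b" if "a \<in> carrier G" "b \<in> carrier G" for a b
    using assms that by (simp add: hom_def)
  have diff3: "h (frag_of p - frag_of q - frag_of r) = h (frag_of p) - h (frag_of q) - h (frag_of r)"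
    if "p \<in> carrier G \<times> UNIV" "q \<in> carrier G \<times> UNIV" "r \<in> carrier G \<times> UNIV" for p q r
  proof -
    have "frag_of p - frag_of q \<in> carrier free_pairs"
      using that keys_diff[of "frag_of p" "frag_of q"] by auto
    then show ?thesis
      using that by (simp add: diff del: carrier_free_Abelian_group_iff)
  qed
  have "h r = 0" if "r \<in> tensor_relations G rat_group" for r
    using that unfolding tensor_relations_def
    by (elim UnE CollectE exE conjE; hypsubst)
      (simp_all add: diff3 h_of \<phi> distrib_left distrib_right)
  then have "tensor_relations G rat_group \<subseteq> kernel free_pairs rat_group h"
    using tensor_relations_closed unfolding kernel_def by force
  then have ker: "bilinear_span \<subseteq> kernel free_pairs rat_group h"
    unfolding bilinear_span_def by (rule F.generate_subgroup_incl[OF _ h.subgroup_kernel])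
  have "h u = h v" if "u \<in> carrier free_pairs" "v \<in> carrier free_pairs"
    "bilinear_span #>\<^bsub>free_pairs\<^esub> u = bilinear_span #>\<^bsub>free_pairs\<^esub> v" for u v
  proof -
    have "u \<in> bilinear_span #>\<^bsub>free_pairs\<^esub> v"
      using that F.rcos_self F.is_subgroup by blast
    then obtain n where "n \<in> bilinear_span" "u = n + v"
      by (auto simp: r_coset_def)
    with ker that show ?thesis
      using h.hom_mult[of n v] by (auto simp: kernel_def)
  qed
  then obtain \<Phi> where "\<Phi> \<in> hom (free_pairs Mod bilinear_span) rat_group"
    "\<And>u. u \<in> carrier free_pairs \<Longrightarrow> \<Phi> (bilinear_span #>\<^bsub>free_pairs\<^esub> u) = h u"
    using FactGroup_universal[OF h bilinear_span_normal] by blast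
  then show thesis
    by (intro that[of \<Phi>]) (simp_all add: tensor_eq pure_def h_of)
qed

text \<open>
  Three tensors, brought to the form \<open>a i \<otimes> 1 / d i\<close>, give three vectors in \<open>\<int>\<^sup>2\<close>, hence an integral
  relation between the images of the \<open>a i\<close>.  It holds for the \<open>a i\<close> themselves up to torsion, and
  torsion disappears in the tensor product.
\<close>

lemma abelian_rank_tensor_le_2:
  assumes \<phi>: "\<phi> \<in> hom G integer_group" and \<psi>: "\<psi> \<in> hom G integer_group"
    and torsion: "\<And>a. \<lbrakk>a \<in> carrier G; \<phi> a = 0; \<psi> a = 0\<rbrakk> \<Longrightarrow> \<exists>n > 0 :: int. a [^] n = \<one>"
  shows "abelian_rank (tensor_product G rat_group) \<le> 2"
  unfolding abelian_rank_def
proof (rule SUP_least)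
  interpret T: comm_group "tensor_product G rat_group" by (rule comm_group_tensor)
  let ?T = "tensor_product G rat_group"
  fix B assume "B \<in> {B. finite B \<and> B \<subseteq> carrier ?T \<and> int_independent ?T B}"
  then have B: "finite B" "B \<subseteq> carrier ?T" "int_independent ?T B" by auto
  show "enat (card B) \<le> 2"
  proof (rule ccontr)
    assume "\<not> enat (card B) \<le> 2"
    then have "3 \<le> card B"
      by (simp add: numeral_eq_enat)
    then obtain C where C: "C \<subseteq> B" "card C = 3"
      by (metis obtain_subset_with_card_n)
    then obtain \<beta>0 \<beta>1 \<beta>2 where C_eq: "C = {\<beta>0, \<beta>1, \<beta>2}"
      and ne: "\<beta>0 \<noteq> \<beta>1" "\<beta>0 \<noteq> \<beta>2" "\<beta>1 \<noteq> \<beta>2"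
      by (auto simp: card_3_iff)
    define \<beta> where "\<beta> i = (if i = 0 then \<beta>0 else if i = 1 then \<beta>1 else \<beta>2)" for i :: nat
    have \<beta>_in: "\<beta> i \<in> carrier ?T" for i
      using B(2) C C_eq by (auto simp: \<beta>_def)
    have "\<exists>a d. a \<in> carrier G \<and> d > 0 \<and> \<beta> i = pure a (1 / of_int d)" for i
      using tensor_pure[OF \<beta>_in[of i]] by metis
    then obtain a d where a: "\<And>i. a i \<in> carrier G" and d: "\<And>i. d i > 0"
      and pure: "\<And>i. \<beta> i = pure (a i) (1 / of_int (d i))"
      by metis
    obtain m :: "nat \<Rightarrow> int" where m: "m 0 \<noteq> 0 \<or> m 1 \<noteq> 0 \<or> m 2 \<noteq> 0"
      "m 0 * \<phi> (a 0) + m 1 * \<phi> (a 1) + m 2 * \<phi> (a 2) = 0"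
      "m 0 * \<psi> (a 0) + m 1 * \<psi> (a 1) + m 2 * \<psi> (a 2) = 0"
      using ex_integer_relation[of "\<lambda>i. \<phi> (a i)" "\<lambda>i. \<psi> (a i)"] by blast
    define s where "s = a 0 [^] m 0 \<otimes> a 1 [^] m 1 \<otimes> a 2 [^] m 2"
    have s_in: "s \<in> carrier G"
      by (simp add: s_def a)
    have hom_s: "\<chi> s = m 0 * \<chi> (a 0) + m 1 * \<chi> (a 1) + m 2 * \<chi> (a 2)"
      if "\<chi> \<in> hom G integer_group" for \<chi>
    proof -
      interpret \<chi>: group_hom G integer_group \<chi>
        using that by (intro group_hom.intro group_hom_axioms.intro is_group) simp_all
      show ?thesis by (simp add: s_def a \<chi>.hom_int_pow)
    qed
    obtain n where n: "n > 0" "s [^] (n :: int) = \<one>"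
      using torsion[OF s_in] hom_s[OF \<phi>] hom_s[OF \<psi>] m by auto
    have pow: "\<beta> i [^]\<^bsub>?T\<^esub> (m i * d i * n) = pure (a i [^] m i) 1 [^]\<^bsub>?T\<^esub> n" for i
    proof -
      have "\<beta> i [^]\<^bsub>?T\<^esub> d i = pure (a i) 1"
        unfolding pure using d[of i] pure_int_pow_right[OF a, of i "d i" "1 / of_int (d i)"] by simp
      then have "\<beta> i [^]\<^bsub>?T\<^esub> (d i * m i * n) = (pure (a i) 1 [^]\<^bsub>?T\<^esub> m i) [^]\<^bsub>?T\<^esub> n"
        using \<beta>_in by (simp flip: T.int_pow_pow)
      then show ?thesis
        by (simp add: pure_int_pow_left a mult.commute)
    qed
    define c where "c \<tau> = (if \<tau> = \<beta>0 then m 0 * d 0 * n else if \<tau> = \<beta>1 then m 1 * d 1 * n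
      else if \<tau> = \<beta>2 then m 2 * d 2 * n else 0)" for \<tau>
    have "finprod ?T (\<lambda>b. b [^]\<^bsub>?T\<^esub> c b) B = finprod ?T (\<lambda>b. b [^]\<^bsub>?T\<^esub> c b) C"
      using B C by (intro T.finprod_mono_neutral_cong_right) (auto simp: c_def C_eq)
    also have "\<dots> = \<beta> 0 [^]\<^bsub>?T\<^esub> (m 0 * d 0 * n) \<otimes>\<^bsub>?T\<^esub> \<beta> 1 [^]\<^bsub>?T\<^esub> (m 1 * d 1 * n) \<otimes>\<^bsub>?T\<^esub>
        \<beta> 2 [^]\<^bsub>?T\<^esub> (m 2 * d 2 * n)"
      unfolding C_eq using ne \<beta>_in[of 0] \<beta>_in[of 1] \<beta>_in[of 2]
      by (simp add: c_def \<beta>_def T.m_assoc Pi_def)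
    also have "\<dots> = pure s 1 [^]\<^bsub>?T\<^esub> n"
      unfolding pow s_def by (simp add: pure_mult_left a T.int_pow_distrib)
    also have "\<dots> = \<one>\<^bsub>?T\<^esub>"
      using n s_in by (simp flip: pure_int_pow_left)
    finally have "\<forall>b \<in> B. c b = 0"
      using B(3) by (auto simp: int_independent_def)
    then have "c \<beta>0 = 0" "c \<beta>1 = 0" "c \<beta>2 = 0"
      using C C_eq by auto
    then have "m 0 = 0" "m 1 = 0" "m 2 = 0"
      using ne n d[of 0] d[of 1] d[of 2] by (auto simp: c_def)
    with m show False by simp
  qed
qed

text \<open>
  The functionals that extend \<open>\<phi>\<close> and \<open>\<psi>\<close> turn a relation between \<open>a \<otimes> 1\<close> and \<open>b \<otimes> 1\<close> into a linear
  system with nonzero determinant.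
\<close>

lemma abelian_rank_tensor_ge_2:
  assumes \<phi>: "\<phi> \<in> hom G integer_group" and \<psi>: "\<psi> \<in> hom G integer_group"
    and ab: "a \<in> carrier G" "b \<in> carrier G" and det: "\<phi> a * \<psi> b \<noteq> \<phi> b * \<psi> a"
  shows "2 \<le> abelian_rank (tensor_product G rat_group)"
proof -
  interpret T: comm_group "tensor_product G rat_group" by (rule comm_group_tensor)
  let ?T = "tensor_product G rat_group"
  let ?a = "pure a 1" and ?b = "pure b 1"
  have rel: "m = 0 \<and> n = 0" if "?a [^]\<^bsub>?T\<^esub> m \<otimes>\<^bsub>?T\<^esub> ?b [^]\<^bsub>?T\<^esub> n = \<one>\<^bsub>?T\<^esub>" for m n :: int
  proof -
    have zero: "m * \<chi> a + n * \<chi> b = 0" if \<chi>: "\<chi> \<in> hom G integer_group" for \<chi>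
    proof -
      obtain \<Phi> where \<Phi>: "\<Phi> \<in> hom ?T rat_group" "\<And>a q. a \<in> carrier G \<Longrightarrow> \<Phi> (pure a q) = of_int (\<chi> a) * q"
        using tensor_hom[OF \<chi>] by metis
      interpret \<Phi>: group_hom ?T rat_group \<Phi>
        using \<Phi> comm_group_rat_group
        by (intro group_hom.intro group_hom_axioms.intro T.is_group) (simp_all add: comm_group_def)
      have "?a [^]\<^bsub>?T\<^esub> m = pure a (of_int m)" "?b [^]\<^bsub>?T\<^esub> n = pure b (of_int n)"
        using ab pure_int_pow_right[of _ _ 1] by auto
      then have "\<Phi> (pure a (of_int m) \<otimes>\<^bsub>?T\<^esub> pure b (of_int n)) = 0"
        using \<open>_ = \<one>\<^bsub>?T\<^esub>\<close> \<Phi>.hom_one by simp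
      then have "of_int (\<chi> a) * of_int m + of_int (\<chi> b) * of_int n = (0 :: rat)"
        using ab \<Phi> by simp
      then have "of_int (m * \<chi> a + n * \<chi> b) = (0 :: rat)"
        by (simp add: mult.commute)
      then show ?thesis by (simp only: of_int_eq_0_iff)
    qed
    have "m * (\<phi> a * \<psi> b - \<phi> b * \<psi> a) = (m * \<phi> a + n * \<phi> b) * \<psi> b - (m * \<psi> a + n * \<psi> b) * \<phi> b"
      "n * (\<phi> a * \<psi> b - \<phi> b * \<psi> a) = (m * \<psi> a + n * \<psi> b) * \<phi> a - (m * \<phi> a + n * \<phi> b) * \<psi> a"
      by (simp_all add: algebra_simps)
    then have "m * (\<phi> a * \<psi> b - \<phi> b * \<psi> a) = 0" "n * (\<phi> a * \<psi> b - \<phi> b * \<psi> a) = 0"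
      by (simp_all only: zero[OF \<phi>] zero[OF \<psi>] mult_zero_left diff_self)
    with det show ?thesis by simp
  qed
  have ne: "?a \<noteq> ?b"
  proof
    assume "?a = ?b"
    then have "?a [^]\<^bsub>?T\<^esub> (1 :: int) \<otimes>\<^bsub>?T\<^esub> ?b [^]\<^bsub>?T\<^esub> (-1 :: int) = \<one>\<^bsub>?T\<^esub>"
      using ab by (simp add: T.int_pow_neg)
    from rel[OF this] show False by simp
  qed
  have "int_independent ?T {?a, ?b}"
    unfolding int_independent_def
    using rel ne ab by (auto simp: Pi_def)
  then have "enat (card {?a, ?b}) \<le> abelian_rank ?T"
    unfolding abelian_rank_def using ab by (intro SUP_upper) auto
  then show ?thesis
    using ne by (simp add: numeral_eq_enat numeral_2_eq_2)
qed

end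

text \<open>
  Both homomorphisms factor through the abelianization, in which the elements that they kill are
  torsion; so the two estimates of the rank apply to it.
\<close>

proposition first_betti_eq_2:
  assumes "group H" and \<phi>: "\<phi> \<in> hom H integer_group" and \<psi>: "\<psi> \<in> hom H integer_group"
    and torsion: "\<And>h. \<lbrakk>h \<in> carrier H; \<phi> h = 0; \<psi> h = 0\<rbrakk> \<Longrightarrow>
      \<exists>n > 0 :: int. h [^]\<^bsub>H\<^esub> n \<in> derived H (carrier H)"
    and ab: "a \<in> carrier H" "b \<in> carrier H" and det: "\<phi> a * \<psi> b \<noteq> \<phi> b * \<psi> a"
  shows "first_betti H = 2"
proof -
  interpret H: group H by fact
  let ?D = "derived H (carrier H)"
  interpret D: normal ?D H by (rule H.derived_self_is_normal)
  interpret A: comm_group "abelianization H"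
    unfolding abelianization_def by (rule H.derived_quot_is_comm_group)
  have factor: "\<exists>\<chi>'. \<chi>' \<in> hom (abelianization H) integer_group \<and>
      (\<forall>h \<in> carrier H. \<chi>' (?D #>\<^bsub>H\<^esub> h) = \<chi> h)" if \<chi>: "\<chi> \<in> hom H integer_group" for \<chi>
  proof -
    interpret \<chi>: group_hom H integer_group \<chi>
      using \<chi> by (intro group_hom.intro group_hom_axioms.intro H.is_group) simp_all
    have "\<chi> ` ?D = derived integer_group (\<chi> ` carrier H)"
      by (simp add: \<chi>.derived_img)
    then have zero: "\<chi> n = 0" if "n \<in> ?D" for n
      using that comm_group.derived_eq_singleton[OF abelian_integer_group, of "\<chi> ` carrier H"] by auto
    have "\<chi> g = \<chi> h" if "g \<in> carrier H" "h \<in> carrier H" "?D #>\<^bsub>H\<^esub> g = ?D #>\<^bsub>H\<^esub> h" for g h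
    proof -
      have "g \<in> ?D #>\<^bsub>H\<^esub> h"
        using that H.rcos_self D.is_subgroup by blast
      then obtain n where "n \<in> ?D" "g = n \<otimes>\<^bsub>H\<^esub> h"
        by (auto simp: r_coset_def)
      with that show ?thesis by (simp add: zero)
    qed
    then show ?thesis
      using FactGroup_universal[OF \<chi> H.derived_self_is_normal]
      unfolding abelianization_def by metis
  qed
  obtain \<phi>' where \<phi>': "\<phi>' \<in> hom (abelianization H) integer_group"
    "\<And>h. h \<in> carrier H \<Longrightarrow> \<phi>' (?D #>\<^bsub>H\<^esub> h) = \<phi> h"
    using factor[OF \<phi>] by blast
  obtain \<psi>' where \<psi>': "\<psi>' \<in> hom (abelianization H) integer_group"
    "\<And>h. h \<in> carrier H \<Longrightarrow> \<psi>' (?D #>\<^bsub>H\<^esub> h) = \<psi> h"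
    using factor[OF \<psi>] by blast
  have in_A: "?D #>\<^bsub>H\<^esub> h \<in> carrier (abelianization H)" if "h \<in> carrier H" for h
    using that by (simp add: abelianization_def carrier_FactGroup)
  show ?thesis
    unfolding first_betti_def
  proof (rule antisym)
    show "abelian_rank (tensor_product (abelianization H) rat_group) \<le> 2"
    proof (rule A.abelian_rank_tensor_le_2[OF \<phi>'(1) \<psi>'(1)])
      fix a assume a: "a \<in> carrier (abelianization H)" "\<phi>' a = 0" "\<psi>' a = 0"
      then obtain h where h: "h \<in> carrier H" "a = ?D #>\<^bsub>H\<^esub> h"
        by (auto simp: abelianization_def carrier_FactGroup)
      with a torsion[of h] obtain n :: int where n: "n > 0" "h [^]\<^bsub>H\<^esub> n \<in> ?D"
        by (auto simp: \<phi>' \<psi>')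
      then have "a [^]\<^bsub>abelianization H\<^esub> n = \<one>\<^bsub>abelianization H\<^esub>"
        using h by (simp add: abelianization_def D.FactGroup_int_pow H.coset_join2 D.is_subgroup)
      with n show "\<exists>n > 0 :: int. a [^]\<^bsub>abelianization H\<^esub> n = \<one>\<^bsub>abelianization H\<^esub>"
        by blast
    qed
    show "2 \<le> abelian_rank (tensor_product (abelianization H) rat_group)"
      by (rule A.abelian_rank_tensor_ge_2[OF \<phi>'(1) \<psi>'(1) in_A[OF ab(1)] in_A[OF ab(2)]])
        (simp add: \<phi>' \<psi>' ab det)
  qed
qed

section \<open>Finite abelian covers\<close>

theorem theorem3:
  fixes \<Gamma> :: "('a, 'm) monoid_scheme"
    and G :: "('b, 'n) monoid_scheme"
    and \<alpha> :: "'a \<Rightarrow> 'b"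
  assumes "group \<Gamma>"
    and "\<Gamma> \<cong> cartwright_steger_group"
    and "comm_group G"
    and "finite (carrier G)"
    and "\<alpha> \<in> epi \<Gamma> G"
  shows "first_betti (\<Gamma>\<lparr>carrier := kernel \<Gamma> G \<alpha>\<rparr>) = first_betti \<Gamma> \<and> first_betti \<Gamma> = 2"
proof -
  interpret group \<Gamma> by fact
  interpret G: comm_group G by fact
  interpret \<alpha>: group_hom \<Gamma> G \<alpha>
    using assms(5) by (intro group_hom.intro group_hom_axioms.intro is_group G.is_group)
      (simp add: epi_def)
  let ?K = "kernel \<Gamma> G \<alpha>"
  let ?\<Delta> = "\<Gamma>\<lparr>carrier := ?K\<rparr>"
  obtain \<phi> \<psi> a b where hom: "\<phi> \<in> hom \<Gamma> integer_group" "\<psi> \<in> hom \<Gamma> integer_group"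
    and ab: "a \<in> carrier \<Gamma>" "b \<in> carrier \<Gamma>" "\<phi> a = 1" "\<psi> a = 0" "\<phi> b = 0" "\<psi> b = 1"
    and torsion: "\<And>g. \<lbrakk>g \<in> carrier \<Gamma>; \<phi> g = 0; \<psi> g = 0\<rbrakk> \<Longrightarrow>
       g [^]\<^bsub>\<Gamma>\<^esub> (56 :: int) \<in> derived \<Gamma> (derived \<Gamma> (carrier \<Gamma>))"
    using cartwright_steger_homs[OF assms(1,2)] by blast
  interpret \<phi>: group_hom \<Gamma> integer_group \<phi>
    using hom by (intro group_hom.intro group_hom_axioms.intro is_group) simp_all
  interpret \<psi>: group_hom \<Gamma> integer_group \<psi>
    using hom by (intro group_hom.intro group_hom_axioms.intro is_group) simp_all
  have K: "subgroup ?K \<Gamma>"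
    by (rule \<alpha>.subgroup_kernel)
  \<comment> \<open>The derived subgroup dies in the abelian group \<open>G\<close>, so that \<open>\<Gamma>'' \<le> K'\<close>.\<close>
  have "\<alpha> ` carrier \<Gamma> \<subseteq> carrier G"
    by auto
  then have "\<alpha> ` derived \<Gamma> (carrier \<Gamma>) \<subseteq> {\<one>\<^bsub>G\<^esub>}"
    using G.derived_eq_singleton[of "\<alpha> ` carrier \<Gamma>"] \<alpha>.derived_img[of "carrier \<Gamma>"] by auto
  then have "derived \<Gamma> (carrier \<Gamma>) \<subseteq> ?K"
    using derived_in_carrier[of "carrier \<Gamma>"] by (auto simp: kernel_def)
  then have "derived \<Gamma> (derived \<Gamma> (carrier \<Gamma>)) \<subseteq> derived ?\<Delta> ?K"
    by (simp add: derived_consistent K mono_derived)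
  then have torsion_K: "h [^]\<^bsub>?\<Delta>\<^esub> (56 :: int) \<in> derived ?\<Delta> (carrier ?\<Delta>)"
    if "h \<in> carrier ?\<Delta>" "\<phi> h = 0" "\<psi> h = 0" for h
    using that torsion[of h] subgroup.subset[OF K] by (auto simp flip: int_pow_consistent[OF K])
  have order: "order G > 0"
    using assms(4) by (simp add: G.order_gt_0_iff_finite)
  \<comment> \<open>Powers of the two basis elements with exponent \<open>|G|\<close> show that the image of the kernel
      in \<open>\<int>\<^sup>2\<close> has rank 2.\<close>
  have power: "g [^]\<^bsub>\<Gamma>\<^esub> order G \<in> ?K" if "g \<in> carrier \<Gamma>" for g
    using that by (simp add: kernel_def \<alpha>.hom_nat_pow G.pow_order_eq_1)
  have betti_K: "first_betti ?\<Delta> = 2"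
  proof (rule first_betti_eq_2)
    show "group ?\<Delta>" by (rule subgroup.subgroup_is_group[OF K assms(1)])
    show "\<phi> \<in> hom ?\<Delta> integer_group" "\<psi> \<in> hom ?\<Delta> integer_group"
      using subgroup.mem_carrier[OF K] by (auto intro!: homI)
    show "a [^]\<^bsub>\<Gamma>\<^esub> order G \<in> carrier ?\<Delta>" "b [^]\<^bsub>\<Gamma>\<^esub> order G \<in> carrier ?\<Delta>"
      using power ab by simp_all
    show "\<phi> (a [^]\<^bsub>\<Gamma>\<^esub> order G) * \<psi> (b [^]\<^bsub>\<Gamma>\<^esub> order G) \<noteq> \<phi> (b [^]\<^bsub>\<Gamma>\<^esub> order G) * \<psi> (a [^]\<^bsub>\<Gamma>\<^esub> order G)"
      using order ab by (simp add: \<phi>.hom_nat_pow \<psi>.hom_nat_pow)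
    show "\<exists>n > 0 :: int. h [^]\<^bsub>?\<Delta>\<^esub> n \<in> derived ?\<Delta> (carrier ?\<Delta>)"
      if "h \<in> carrier ?\<Delta>" "\<phi> h = 0" "\<psi> h = 0" for h
      using torsion_K[OF that] by (intro exI[of _ 56]) simp
  qed
  moreover have "first_betti \<Gamma> = 2"
  proof (rule first_betti_eq_2[OF assms(1) hom _ ab(1,2)])
    show "\<exists>n > 0 :: int. g [^]\<^bsub>\<Gamma>\<^esub> n \<in> derived \<Gamma> (carrier \<Gamma>)"
      if "g \<in> carrier \<Gamma>" "\<phi> g = 0" "\<psi> g = 0" for g
      using torsion[OF that] mono_derived[OF derived_in_carrier[of "carrier \<Gamma>"]]
      by (intro exI[of _ 56]) auto
  qed (simp add: ab)
  ultimately show ?thesis by simp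
qed

end
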